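(* Let $\rho:\Gamma\rightarrow\mathsf{GL}_d(\mathbb{K})$ be a representation admitting a continuous, $\rho$-equivariant, injective map $\xi_\rho:(\partial_\infty X,d_a)\rightarrow(\mathbb{P}(\mathbb{K}^d),d_{\mathbb{P}})$. The inverse of $\xi_\rho$ (defined on $\xi_\rho(\partial_\infty X)$) is H\"older continuous, and there exist $c,\beta>0$ such that $$d_{\mathbb{P}}\big(\xi_\rho(x),\xi_\rho(y)\big)\ge c\,d_a(x,y)^\beta\qquad\text{for all }x,y\in\partial_\infty X.$$
   Context: $\Gamma$ is a non-elementary word hyperbolic group with a fixed $\Gamma$-model space $(X,d_X)$: a proper geodesic Gromov hyperbolic metric space on which $\Gamma$ acts isometrically, properly discontinuously and cocompactly. Fix $x_0\in X$. The Gromov product is $(x\cdot y)_{x_0}=\frac12(d_X(x,x_0)+d_X(y,x_0)-d_X(x,y))$ on $X$, and on the Gromov boundary $\partial_\infty X$ it is $(x\cdot y)_{x_0}=\sup\{\liminf_{m,n\to\infty}(x_m\cdot y_n)_{x_0}: x_m\to x,\ y_n\to y\}$. $d_a$, $a>1$, is a visual metric on $\partial_\infty X$: there is $r>1$ with $r^{-1}a^{-(x\cdot y)_{x_0}}\le d_a(x,y)\le r a^{-(x\cdot y)_{x_0}}$ for all $x,y\in\partial_\infty X$. $\mathbb{K}=\mathbb{R}$ or $\mathbb{C}$ and $d_{\mathbb{P}}([v_1],[v_2])=\cos^{-1}\big(|\langle v_1,v_2\rangle|/(\|v_1\|\|v_2\|)\big)$. *)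

theory Defs
  imports "HOL-Analysis.Analysis" "HOL-Algebra.Group_Action" "HOL-Algebra.Generated_Groups"
begin

section \<open>Gromov hyperbolicity and the Gromov boundary\<close>

definition gromov_product :: "('a \<Rightarrow> 'a \<Rightarrow> real) \<Rightarrow> 'a \<Rightarrow> 'a \<Rightarrow> 'a \<Rightarrow> real" where
  "gromov_product d w x y = (d x w + d y w - d x y) / 2"

text \<open>Gromov's four-point condition, for a distance \<open>d\<close> on a carrier \<open>M\<close>.\<close>

definition gromov_hyperbolic :: "'a set \<Rightarrow> ('a \<Rightarrow> 'a \<Rightarrow> real) \<Rightarrow> bool" where
  "gromov_hyperbolic M d \<longleftrightarrow>
    (\<exists>\<delta>\<ge>0. \<forall>w\<in>M. \<forall>x\<in>M. \<forall>y\<in>M. \<forall>z\<in>M.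
      gromov_product d w x z \<ge> min (gromov_product d w x y) (gromov_product d w y z) - \<delta>)"

definition proper_space :: "'x::metric_space itself \<Rightarrow> bool" where
  "proper_space _ \<longleftrightarrow> (\<forall>(x::'x) r. compact (cball x r))"

definition geodesic_space :: "'x::metric_space itself \<Rightarrow> bool" where
  "geodesic_space _ \<longleftrightarrow> (\<forall>x y::'x. \<exists>c::real \<Rightarrow> 'x. c 0 = x \<and> c (dist x y) = y \<and>
     (\<forall>s\<in>{0..dist x y}. \<forall>t\<in>{0..dist x y}. dist (c s) (c t) = \<bar>s - t\<bar>))"

text \<open>
  Boundary points are represented as equivalence classes of sequences converging to infinity.
  Thus, for a boundary point \<open>x\<close>, \<open>s \<in> x\<close> says that the sequence \<open>s\<close> in the space converges to \<open>x\<close>.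
\<close>

definition asymptotic :: "'x::metric_space \<Rightarrow> (nat \<Rightarrow> 'x) \<Rightarrow> (nat \<Rightarrow> 'x) \<Rightarrow> bool" where
  "asymptotic x\<^sub>0 s t \<longleftrightarrow>
    filterlim (\<lambda>(m, n). gromov_product dist x\<^sub>0 (s m) (t n)) at_top (sequentially \<times>\<^sub>F sequentially)"

definition gromov_sequences :: "'x::metric_space \<Rightarrow> (nat \<Rightarrow> 'x) set" where
  "gromov_sequences x\<^sub>0 = {s. asymptotic x\<^sub>0 s s}"

definition gromov_boundary :: "'x::metric_space \<Rightarrow> (nat \<Rightarrow> 'x) set set" where
  "gromov_boundary x\<^sub>0 = gromov_sequences x\<^sub>0 //
     {(s, t). s \<in> gromov_sequences x\<^sub>0 \<and> t \<in> gromov_sequences x\<^sub>0 \<and> asymptotic x\<^sub>0 s t}"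

text \<open>The Gromov product on the boundary is extended-real valued: it is \<open>\<infinity>\<close> on the diagonal.\<close>

definition boundary_product ::
    "'x::metric_space \<Rightarrow> (nat \<Rightarrow> 'x) set \<Rightarrow> (nat \<Rightarrow> 'x) set \<Rightarrow> ereal" where
  "boundary_product x\<^sub>0 x y =
    (SUP (s, t) \<in> x \<times> y. Liminf (sequentially \<times>\<^sub>F sequentially)
        (\<lambda>(m, n). ereal (gromov_product dist x\<^sub>0 (s m) (t n))))"

text \<open>\<open>exp_neg a t\<close> is \<open>a\<close> to the power \<open>-t\<close>, with the convention that it vanishes for \<open>t = \<infinity>\<close>.\<close>

definition exp_neg :: "real \<Rightarrow> ereal \<Rightarrow> real" where
  "exp_neg a t = (if t = \<infinity> then 0 else a powr (- real_of_ereal t))"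

definition visual_metric ::
    "'x::metric_space \<Rightarrow> real \<Rightarrow> ((nat \<Rightarrow> 'x) set \<Rightarrow> (nat \<Rightarrow> 'x) set \<Rightarrow> real) \<Rightarrow> bool" where
  "visual_metric x\<^sub>0 a d \<longleftrightarrow> Metric_space (gromov_boundary x\<^sub>0) d \<and>
    (\<exists>r>1. \<forall>x\<in>gromov_boundary x\<^sub>0. \<forall>y\<in>gromov_boundary x\<^sub>0.
       inverse r * exp_neg a (boundary_product x\<^sub>0 x y) \<le> d x y \<and>
       d x y \<le> r * exp_neg a (boundary_product x\<^sub>0 x y))"


section \<open>Hyperbolic groups and model spaces\<close>

definition word_length :: "('g, 'b) monoid_scheme \<Rightarrow> 'g set \<Rightarrow> 'g \<Rightarrow> nat" where
  "word_length G S g = (LEAST n. \<exists>ws. length ws = n \<and> set ws \<subseteq> S \<union> m_inv G ` S \<and>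
     foldr (mult G) ws (one G) = g)"

definition word_metric :: "('g, 'b) monoid_scheme \<Rightarrow> 'g set \<Rightarrow> 'g \<Rightarrow> 'g \<Rightarrow> real" where
  "word_metric G S g h = real (word_length G S (inv\<^bsub>G\<^esub> g \<otimes>\<^bsub>G\<^esub> h))"

definition word_hyperbolic :: "('g, 'b) monoid_scheme \<Rightarrow> bool" where
  "word_hyperbolic G \<longleftrightarrow> group G \<and>
    (\<exists>S. finite S \<and> S \<subseteq> carrier G \<and> generate G S = carrier G \<and>
         gromov_hyperbolic (carrier G) (word_metric G S))"

text \<open>Elementary means virtually cyclic; finite groups are included (take the trivial subgroup).\<close>

definition elementary :: "('g, 'b) monoid_scheme \<Rightarrow> bool" where
  "elementary G \<longleftrightarrow> (\<exists>h\<in>carrier G. finite (rcosets\<^bsub>G\<^esub> (generate G {h})))"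

definition model_space :: "('g, 'b) monoid_scheme \<Rightarrow> ('g \<Rightarrow> 'x::metric_space \<Rightarrow> 'x) \<Rightarrow> bool" where
  "model_space G \<phi> \<longleftrightarrow>
     proper_space TYPE('x) \<and> geodesic_space TYPE('x) \<and> gromov_hyperbolic (UNIV :: 'x set) dist \<and>
     group_action G UNIV \<phi> \<and>
     (\<forall>g\<in>carrier G. \<forall>x y. dist (\<phi> g x) (\<phi> g y) = dist x y) \<and>
     (\<forall>K. compact K \<longrightarrow> finite {g \<in> carrier G. \<phi> g ` K \<inter> K \<noteq> {}}) \<and>
     (\<exists>K. compact K \<and> (\<Union>g\<in>carrier G. \<phi> g ` K) = UNIV)"

definition boundary_action :: "('g \<Rightarrow> 'x \<Rightarrow> 'x) \<Rightarrow> 'g \<Rightarrow> (nat \<Rightarrow> 'x) set \<Rightarrow> (nat \<Rightarrow> 'x) set" where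
  "boundary_action \<phi> g x = (\<lambda>s. \<phi> g \<circ> s) ` x"


section \<open>The general linear group and projective space\<close>

definition GL :: "('k::field ^ 'n ^ 'n) monoid" where
  "GL = \<lparr>carrier = {A. invertible A}, mult = (**), one = mat 1\<rparr>"

lemma group_GL: "group (GL :: ('k::field ^ 'n ^ 'n) monoid)"
proof (rule groupI)
  fix A :: "'k ^ 'n ^ 'n" assume "A \<in> carrier GL"
  then obtain B where "A ** B = mat 1" "B ** A = mat 1"
    by (auto simp: GL_def invertible_def)
  then show "\<exists>B\<in>carrier GL. B \<otimes>\<^bsub>GL\<^esub> A = \<one>\<^bsub>GL\<^esub>"
    by (auto simp: GL_def invertible_def)
qed (auto simp: GL_def invertible_mult matrix_mul_assoc invertible_def[of "mat 1"])

text \<open>Points of projective space are lines through the origin.\<close>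

definition projective_space :: "('k::field ^ 'n) set set" where
  "projective_space = {vec.span {v} | v. v \<noteq> 0}"

definition projective_action :: "'k::field ^ 'n ^ 'n \<Rightarrow> ('k ^ 'n) set \<Rightarrow> ('k ^ 'n) set" where
  "projective_action A L = (\<lambda>v. A *v v) ` L"

definition cinner :: "complex ^ 'n \<Rightarrow> complex ^ 'n \<Rightarrow> complex" where
  "cinner v w = (\<Sum>i\<in>UNIV. v $ i * cnj (w $ i))"

definition line_rep :: "('k::field ^ 'n) set \<Rightarrow> 'k ^ 'n" where
  "line_rep L = (SOME v. v \<in> L \<and> v \<noteq> 0)"

text \<open>
  The angle between two lines with respect to a scalar product \<open>ip\<close>, which is \<open>inner\<close> over the
  reals and \<open>cinner\<close> over the complex numbers. Independence of the chosen representatives is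
  shown in \<open>inner.proj_dist_span\<close> and \<open>cinner.proj_dist_span\<close> below.
\<close>

definition proj_dist ::
    "('k ^ 'n \<Rightarrow> 'k ^ 'n \<Rightarrow> 'k) \<Rightarrow> ('k::real_normed_field ^ 'n) set \<Rightarrow> ('k ^ 'n) set \<Rightarrow> real" where
  "proj_dist ip L M = (let v = line_rep L; w = line_rep M in
     arccos (norm (ip v w) / (norm v * norm w)))"


subsection \<open>The angle is a metric on projective space\<close>

lemma line_rep:
  fixes v :: "'k::field ^ 'n"
  assumes "v \<noteq> 0"
  obtains c where "c \<noteq> 0" "line_rep (vec.span {v}) = c *s v"
proof -
  have "v \<in> vec.span {v}" by (simp add: vec.span_base)
  then have "\<exists>u. u \<in> vec.span {v} \<and> u \<noteq> 0" using assms by blast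
  then have *: "line_rep (vec.span {v}) \<in> vec.span {v} \<and> line_rep (vec.span {v}) \<noteq> 0"
    unfolding line_rep_def by (rule someI_ex)
  then obtain c where c: "line_rep (vec.span {v}) = c *s v"
    by (auto simp: vec.span_singleton)
  with * have "c \<noteq> 0" by auto
  with c show ?thesis using that by blast
qed

lemma norm_vector_smult: "norm (c *s (v :: 'k::real_normed_field ^ 'n)) = norm c * norm v"
  by (simp add: norm_vec_def norm_mult L2_set_right_distrib)

lemma span_smult:
  fixes v :: "'k::field ^ 'n"
  assumes "c \<noteq> 0"
  shows "vec.span {c *s v} = vec.span {v}"
proof -
  have "k *s v = (k * inverse c) *s (c *s v)" for k
    using assms by (simp add: mult.assoc)
  then have "k *s v \<in> range (\<lambda>k. k *s (c *s v))" for k by blast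
  then show ?thesis by (auto simp: vec.span_singleton)
qed

locale scalar_product =
  fixes ip :: "'k::real_normed_field ^ 'n \<Rightarrow> 'k ^ 'n \<Rightarrow> 'k" and cj :: "'k \<Rightarrow> 'k"
  assumes diff_left: "ip (u - v) w = ip u w - ip v w"
    and smult_left: "ip (c *s v) w = c * ip v w"
    and commute: "ip v w = cj (ip w v)"
    and cj_mult: "cj (b * c) = cj b * cj c"
    and cj_diff: "cj (b - c) = cj b - cj c"
    and norm_cj: "norm (cj c) = norm c"
    and mult_cj: "c * cj c = of_real ((norm c)\<^sup>2)"
    and self: "ip v v = of_real ((norm v)\<^sup>2)"
    and Cauchy_Schwarz: "norm (ip v w) \<le> norm v * norm w"
begin

lemma smult_right: "ip v (c *s w) = cj c * ip v w"
  by (metis cj_mult commute smult_left)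

lemma diff_right: "ip v (u - w) = ip v u - ip v w"
  by (metis cj_diff commute diff_left)

lemma norm_commute: "norm (ip v w) = norm (ip w v)"
  by (metis commute norm_cj)

lemma norm_smult: "norm (ip (b *s v) (c *s w)) = norm b * norm c * norm (ip v w)"
  by (simp add: smult_left smult_right norm_mult norm_cj)

lemma proj_dist_span:
  assumes "v \<noteq> 0" "w \<noteq> 0"
  shows "proj_dist ip (vec.span {v}) (vec.span {w}) = arccos (norm (ip v w) / (norm v * norm w))"
proof -
  obtain b where b: "b \<noteq> 0" "line_rep (vec.span {v}) = b *s v" using line_rep[OF assms(1)] .
  obtain c where c: "c \<noteq> 0" "line_rep (vec.span {w}) = c *s w" using line_rep[OF assms(2)] .
  show ?thesis using b c by (simp add: proj_dist_def norm_smult norm_vector_smult)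
qed

lemma residue:
  assumes "norm v = 1"
  shows "ip (u - ip u v *s v) (w - ip w v *s v) = ip u w - ip u v * ip v w"
proof -
  have "ip v v = 1" using assms by (simp add: self)
  moreover have "cj (ip w v) = ip v w" by (metis commute)
  ultimately show ?thesis
    by (simp add: diff_left diff_right smult_left smult_right algebra_simps)
qed

lemma norm_residue:
  assumes "norm v = 1" "norm u = 1"
  shows "(norm (u - ip u v *s v))\<^sup>2 = 1 - (norm (ip u v))\<^sup>2"
proof -
  have "of_real ((norm (u - ip u v *s v))\<^sup>2) = ip u u - ip u v * ip v u"
    using residue[OF assms(1), of u u] by (simp only: self)
  also have "\<dots> = ip u u - ip u v * cj (ip u v)" by (metis commute)
  also have "\<dots> = of_real (1 - (norm (ip u v))\<^sup>2)" using assms by (simp add: self mult_cj)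
  finally show ?thesis by (simp only: of_real_eq_iff)
qed

lemma unit_le_1: "norm v = 1 \<Longrightarrow> norm w = 1 \<Longrightarrow> norm (ip v w) \<le> 1"
  using Cauchy_Schwarz[of v w] by simp

lemma unit_triangle:
  assumes "norm u = 1" "norm v = 1" "norm w = 1"
  shows "arccos (norm (ip u w)) \<le> arccos (norm (ip u v)) + arccos (norm (ip v w))"
proof -
  define p where "p = norm (ip u v)"
  define q where "q = norm (ip v w)"
  have p: "0 \<le> p" "p \<le> 1" and q: "0 \<le> q" "q \<le> 1"
    using assms unit_le_1 by (auto simp: p_def q_def)
  have nu: "norm (u - ip u v *s v) = sqrt (1 - p\<^sup>2)"
    using norm_residue[of v u] assms by (simp add: p_def real_sqrt_unique)
  have nw: "norm (w - ip w v *s v) = sqrt (1 - q\<^sup>2)"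
    using norm_residue[of v w] assms norm_commute[of w v] by (simp add: q_def real_sqrt_unique)
  have "p * q = norm (ip u v * ip v w)" by (simp add: p_def q_def norm_mult)
  also have "\<dots> \<le> norm (ip u w) + norm (ip u w - ip u v * ip v w)"
    by (metis norm_minus_commute norm_triangle_sub)
  also have "norm (ip u w - ip u v * ip v w) \<le> sqrt (1 - p\<^sup>2) * sqrt (1 - q\<^sup>2)"
    using Cauchy_Schwarz[of "u - ip u v *s v" "w - ip w v *s v"] residue[OF assms(2), of u w] nu nw
    by simp
  finally have "p * q - sqrt (1 - p\<^sup>2) * sqrt (1 - q\<^sup>2) \<le> norm (ip u w)" by simp
  then have le: "cos (arccos p + arccos q) \<le> norm (ip u w)"
    using p q by (simp add: cos_add sin_arccos)
  have "0 \<le> arccos p + arccos q" using p q by (simp add: arccos_lbound)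
  moreover have "arccos p + arccos q \<le> pi"
    using arccos_le_pi2[of p] arccos_le_pi2[of q] p q by simp
  ultimately have "arccos (norm (ip u w)) \<le> arccos p + arccos q"
    using arccos_le_arccos[OF _ le] unit_le_1[OF assms(1,3)] arccos_cos by force
  then show ?thesis by (simp add: p_def q_def)
qed

lemma unit_eq:
  assumes "norm u = 1" "norm v = 1" "arccos (norm (ip u v)) = 0"
  shows "vec.span {u} = vec.span {v}"
proof -
  have "norm (ip u v) = 1"
    using assms unit_le_1[of u v] cos_arccos[of "norm (ip u v)"]
    by (smt (verit) cos_zero norm_ge_zero)
  then have "u = ip u v *s v" "ip u v \<noteq> 0"
    using norm_residue[of v u] assms by auto
  then show ?thesis by (metis span_smult)
qed

lemma unit_line:
  fixes L :: "('k ^ 'n) set"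
  assumes "L \<in> projective_space"
  obtains u where "norm u = 1" "L = vec.span {u}"
proof -
  obtain v where v: "v \<noteq> 0" "L = vec.span {v}" using assms by (auto simp: projective_space_def)
  define c where "c = (of_real (inverse (norm v)) :: 'k)"
  have c: "c \<noteq> 0" using v by (simp add: c_def)
  have "vec.span {c *s v} = vec.span {v}"
    using c by (rule span_smult)
  moreover have "norm (c *s v) = 1" using v by (simp add: norm_vector_smult c_def norm_inverse)
  ultimately show ?thesis using that v by metis
qed

lemma proj_dist_unit:
  assumes "norm v = 1" "norm w = 1"
  shows "proj_dist ip (vec.span {v}) (vec.span {w}) = arccos (norm (ip v w))"
  using assms proj_dist_span[of v w] by fastforce

lemma metric_projective_space: "Metric_space projective_space (proj_dist ip)"
proof
  fix L M
  have "norm (ip v w) / (norm v * norm w) \<le> 1" for v w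
    using Cauchy_Schwarz[of v w] by (cases "v = 0 \<or> w = 0") (auto simp: divide_le_eq_1)
  moreover have "0 \<le> norm (ip v w) / (norm v * norm w)" for v w by simp
  ultimately show "0 \<le> proj_dist ip L M"
    unfolding proj_dist_def Let_def by (intro arccos_lbound) (auto intro: order_trans[of "-1" 0])
  show "proj_dist ip L M = proj_dist ip M L"
    by (simp add: proj_dist_def Let_def norm_commute mult.commute)
next
  fix L M :: "('k ^ 'n) set" assume "L \<in> projective_space" "M \<in> projective_space"
  then obtain u v where uv: "norm u = 1" "L = vec.span {u}" "norm v = 1" "M = vec.span {v}"
    using unit_line by metis
  show "(proj_dist ip L M = 0) = (L = M)"
  proof
    assume "proj_dist ip L M = 0"
    then show "L = M" using unit_eq[of u v] uv by (simp add: proj_dist_unit)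
  next
    assume "L = M"
    then have "proj_dist ip L M = arccos (norm (ip u u))" using uv(1,2) proj_dist_unit by metis
    then show "proj_dist ip L M = 0" using uv by (simp add: self)
  qed
next
  fix L M N :: "('k ^ 'n) set" assume "L \<in> projective_space" "M \<in> projective_space" "N \<in> projective_space"
  then obtain u v w where "norm u = 1" "L = vec.span {u}" "norm v = 1" "M = vec.span {v}"
    "norm w = 1" "N = vec.span {w}"
    using unit_line by metis
  then show "proj_dist ip L N \<le> proj_dist ip L M + proj_dist ip M N"
    using unit_triangle[of u v w] by (simp add: proj_dist_unit)
qed

end

interpretation inner: scalar_product "inner :: real ^ 'n \<Rightarrow> real ^ 'n \<Rightarrow> real" "\<lambda>c. c"
proof
  fix u v w :: "real ^ 'n" and c :: real
  show "inner (u - v) w = inner u w - inner v w" by (rule inner_diff_left)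
  show "inner (c *s v) w = c * inner v w" by (simp add: scalar_mult_eq_scaleR)
  show "inner v w = inner w v" by (rule inner_commute)
  show "inner v v = of_real ((norm v)\<^sup>2)" by (simp add: power2_norm_eq_inner)
  show "norm (inner v w) \<le> norm v * norm w" by (simp add: Cauchy_Schwarz_ineq2)
qed (auto simp: power2_eq_square)

interpretation cinner: scalar_product "cinner :: complex ^ 'n \<Rightarrow> complex ^ 'n \<Rightarrow> complex" cnj
proof
  fix u v w :: "complex ^ 'n" and b c :: complex
  show "cinner (u - v) w = cinner u w - cinner v w"
    by (simp add: cinner_def left_diff_distrib sum_subtractf)
  show smult: "cinner (c *s v) w = c * cinner v w" for c v w
    by (simp add: cinner_def sum_distrib_left mult_ac)
  show "cinner v w = cnj (cinner w v)"
    by (simp add: cinner_def mult.commute)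
  show "c * cnj c = of_real ((norm c)\<^sup>2)" by (simp only: complex_norm_square)
  show "cinner v v = of_real ((norm v)\<^sup>2)"
    by (simp add: cinner_def norm_vec_def L2_set_def sum_nonneg flip: complex_norm_square)
  have Re: "Re (cinner v w) = inner v w" for v w :: "complex ^ 'n"
    by (simp add: cinner_def inner_vec_def inner_complex_def)
  obtain e where e: "norm e = 1" "e * cinner v w = of_real (norm (cinner v w))"
  proof (cases "cinner v w = 0")
    case True then show ?thesis using that[of 1] by simp
  next
    case False
    then show ?thesis
      using that[of "of_real (norm (cinner v w)) / cinner v w"] by (simp add: norm_divide)
  qed
  have "norm (cinner v w) = Re (cinner (e *s v) w)" using e by (simp add: smult)
  also have "\<dots> \<le> norm (e *s v) * norm w" by (simp add: Re norm_cauchy_schwarz)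
  finally show "norm (cinner v w) \<le> norm v * norm w" using e by (simp add: norm_vector_smult)
qed auto


section \<open>Hoelder continuity\<close>

definition hoelder_continuous_on ::
    "'a set \<Rightarrow> ('a \<Rightarrow> 'a \<Rightarrow> real) \<Rightarrow> ('b \<Rightarrow> 'b \<Rightarrow> real) \<Rightarrow> ('a \<Rightarrow> 'b) \<Rightarrow> bool" where
  "hoelder_continuous_on S d d' f \<longleftrightarrow>
    (\<exists>C>0. \<exists>\<alpha>. 0 < \<alpha> \<and> \<alpha> \<le> 1 \<and> (\<forall>u\<in>S. \<forall>v\<in>S. d' (f u) (f v) \<le> C * d u v powr \<alpha>))"

end

theory Submission
  imports Defs
begin

text \<open>
  Seen from a point \<open>p\<close> at distance \<open>t = (x \<cdot> y)\<close> from the base point in the direction of \<open>x\<close>, the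
  boundary points \<open>x\<close> and \<open>y\<close> are far apart. Cocompactness gives a group element \<open>g\<close> that moves \<open>p\<close>
  near the base point, so \<open>g x\<close> and \<open>g y\<close> are uniformly separated, and then so are their images
  under \<open>\<xi>\<close>, because the boundary is compact and \<open>\<xi>\<close> is continuous and injective. Since \<open>g\<close> displaces
  the base point by at most \<open>t\<close> plus a constant, \<open>\<rho> g\<close> expands the sines of projective angles by a
  factor at most exponential in \<open>t\<close>. So the angle between \<open>\<xi> x\<close> and \<open>\<xi> y\<close> is at least exponentially
  small in \<open>t\<close>, that is, at least a power of the visual distance. Choosing the growth constant at
  least \<open>a\<close> makes this power at least 1, as the Hoelder condition for the inverse requires.
\<close>

section \<open>Uniform separation on compact metric spaces\<close>

text \<open>If images of \<open>e\<close>-separated pairs came arbitrarily close, sequential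
  compactness would give a common subsequence along which both members converge. By continuity the
  limits would have equal images, hence be equal by injectivity, against the separation.\<close>

lemma inj_continuous_uniformly_separated:
  assumes "Metric_space M d" "Metric_space M' d'"
    and compact: "compact_space (Metric_space.mtopology M d)"
    and f: "continuous_map (Metric_space.mtopology M d) (Metric_space.mtopology M' d') f"
    and inj: "inj_on f M" and e: "e > 0"
  obtains h where "h > 0" "\<And>u v. u \<in> M \<Longrightarrow> v \<in> M \<Longrightarrow> d u v \<ge> e \<Longrightarrow> d' (f u) (f v) \<ge> h"
proof (rule ccontr)
  assume neg: "\<not> thesis"
  interpret A: Metric_space M d by fact
  interpret B: Metric_space M' d' by fact
  have fM: "f u \<in> M'" if "u \<in> M" for u
    using continuous_map_image_subset_topspace[OF f] that by auto
  have "\<exists>u v. u \<in> M \<and> v \<in> M \<and> d u v \<ge> e \<and> d' (f u) (f v) < inverse (Suc n)" for n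
    using neg that[of "inverse (Suc n)"] by (force simp: not_le)
  then obtain U V where UV: "\<And>n. U n \<in> M" "\<And>n. V n \<in> M" "\<And>n. d (U n) (V n) \<ge> e"
    "\<And>n. d' (f (U n)) (f (V n)) < inverse (Suc n)"
    by metis
  have *: "\<exists>l r. l \<in> M \<and> strict_mono (r::nat \<Rightarrow> nat) \<and> limitin A.mtopology (W \<circ> r) l sequentially"
    if "\<And>n. W n \<in> M" for W
    using compact that unfolding A.compact_space_sequentially by blast
  obtain u r where u: "u \<in> M" "strict_mono (r::nat \<Rightarrow> nat)" "limitin A.mtopology (U \<circ> r) u sequentially"
    using *[of U] UV by blast
  obtain v q where v: "v \<in> M" "strict_mono (q::nat \<Rightarrow> nat)" "limitin A.mtopology (V \<circ> r \<circ> q) v sequentially"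
    using *[of "V \<circ> r"] UV by auto
  have u': "limitin A.mtopology (U \<circ> r \<circ> q) u sequentially"
    using limitin_subsequence[OF v(2) u(3)] .
  have near: "eventually (\<lambda>n. d (U (r (q n))) u < b \<and> d (V (r (q n))) v < b
      \<and> d' (f (U (r (q n)))) (f u) < b \<and> d' (f (V (r (q n)))) (f v) < b) sequentially" if "b > 0" for b
    using u' v(3) continuous_map_limit[OF f u'] continuous_map_limit[OF f v(3)] that
    unfolding A.limitin_metric B.limitin_metric
    by (force elim: eventually_elim2 intro: eventually_conj)
  have "d' (f u) (f v) \<le> 0 + b" if "b > 0" for b
  proof -
    have "eventually (\<lambda>n. inverse (real (Suc n)) < b / 3) sequentially"
      using LIMSEQ_inverse_real_of_nat that by (intro order_tendstoD) auto
    with near[of "b / 3"] that have "eventually (\<lambda>n. inverse (real (Suc n)) < b / 3 \<and>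
      d' (f (U (r (q n)))) (f u) < b / 3 \<and> d' (f (V (r (q n)))) (f v) < b / 3) sequentially"
      by (auto elim: eventually_elim2)
    then obtain n where n: "inverse (real (Suc n)) < b / 3"
      "d' (f (U (r (q n)))) (f u) < b / 3" "d' (f (V (r (q n)))) (f v) < b / 3"
      using eventually_happens'[OF sequentially_bot] by blast
    \<comment> \<open>The images are close at the original index \<open>r (q n)\<close>;
      subsequences only increase indices, so the bound at \<open>n\<close> applies as well.\<close>
    have "n \<le> r (q n)" using seq_suble[OF u(2)] seq_suble[OF v(2)] le_trans by blast
    then have "inverse (real (Suc (r (q n)))) \<le> inverse (real (Suc n))" by (simp add: field_simps)
    then have "d' (f (U (r (q n)))) (f (V (r (q n)))) < b / 3" using UV(4)[of "r (q n)"] n(1) by linarith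
    moreover have "d' (f u) (f v) \<le> d' (f (U (r (q n)))) (f u)
        + (d' (f (U (r (q n)))) (f (V (r (q n)))) + d' (f (V (r (q n)))) (f v))"
      using B.triangle[of "f u" "f (U (r (q n)))" "f v"] B.triangle[of "f (U (r (q n)))" "f (V (r (q n)))" "f v"]
        fM UV u v B.commute[of "f u" "f (U (r (q n)))"] by fastforce
    ultimately show ?thesis using n by linarith
  qed
  then have "d' (f u) (f v) \<le> 0" by (rule field_le_epsilon)
  then have "f u = f v" using B.nonneg[of "f u" "f v"] B.zero fM u v by fastforce
  then have "u = v" using inj u v by (auto dest: inj_onD)
  obtain n where "d (U (r (q n))) u < e / 2" "d (V (r (q n))) v < e / 2"
    using eventually_happens'[OF sequentially_bot near[of "e / 2"]] e by auto
  then show False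
    using UV(1,2) UV(3)[of "r (q n)"] \<open>u = v\<close> u A.triangle[of "U (r (q n))" u "V (r (q n))"]
      A.commute[of u "V (r (q n))"] by fastforce
qed

section \<open>Projective transformations\<close>

lemma matrix_vector_mult_bound:
  fixes A :: "'k::real_normed_field ^ 'n ^ 'm"
  obtains B where "B > 0" "\<And>v. norm (A *v v) \<le> B * norm v"
proof
  \<comment> \<open>The summand 1 keeps the bound positive when \<open>A\<close> is zero.\<close>
  let ?B = "(\<Sum>i\<in>UNIV. \<Sum>j\<in>UNIV. norm (A $ i $ j)) + 1"
  show "?B > 0" by (simp add: sum_nonneg add_nonneg_pos)
  fix v :: "'k ^ 'n"
  have "norm (A *v v) \<le> (\<Sum>i\<in>UNIV. norm ((A *v v) $ i))"
    unfolding norm_vec_def by (rule L2_set_le_sum) simp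
  also have "\<dots> \<le> (\<Sum>i\<in>UNIV. \<Sum>j\<in>UNIV. norm (A $ i $ j) * norm v)"
    unfolding matrix_vector_mult_def
    by (auto intro!: sum_mono sum_norm_le order_trans[OF norm_sum] mult_left_mono
        Finite_Cartesian_Product.norm_nth_le simp: norm_mult)
  also have "\<dots> \<le> ?B * norm v"
    by (simp add: sum_distrib_right distrib_right)
  finally show "norm (A *v v) \<le> ?B * norm v" .
qed

lemma projective_action_span: "projective_action A (vec.span {v}) = vec.span {A *v v}"
  by (auto simp: projective_action_def vec.span_singleton vec.scale image_image)

lemma invertible_mult_vec_eq_0:
  fixes A :: "'k::field ^ 'n ^ 'n"
  assumes "invertible A" "A *v v = 0" shows "v = 0"
  using assms by (metis invertible_def matrix_vector_mul_assoc matrix_vector_mul_lid matrix_vector_mult_0_right)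

lemma projective_action_closed:
  fixes A :: "'k::field ^ 'n ^ 'n"
  assumes "invertible A" "L \<in> projective_space"
  shows "projective_action A L \<in> projective_space"
  using assms(2) projective_action_span[of A] invertible_mult_vec_eq_0[OF assms(1)]
  unfolding projective_space_def by blast

lemma projective_action_mult:
  fixes A B :: "'k::field ^ 'n ^ 'n"
  shows "projective_action (A ** B) L = projective_action A (projective_action B L)"
  by (simp add: projective_action_def image_image matrix_vector_mul_assoc)

section \<open>Sines of projective angles under linear maps\<close>

context scalar_product
begin

lemma ip_residue_self:
  assumes "norm v = 1" shows "ip (u - ip u v *s v) v = 0"
  using assms by (simp add: diff_left smult_left self)

text \<open>\<open>ip u v *s v\<close> is the orthogonal projection of \<open>u\<close> to the line
  of \<open>v\<close>, hence its nearest point there: pairing the residue with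
  \<open>u - c *s v\<close> gives the squared norm of the residue, and Cauchy-Schwarz
  concludes.\<close>

lemma norm_residue_le:
  assumes "norm v = 1"
  shows "norm (u - ip u v *s v) \<le> norm (u - c *s v)"
proof -
  let ?r = "u - ip u v *s v"
  have "ip ?r (u - c *s v) = ip ?r ?r"
    by (simp add: diff_right[of ?r] smult_right ip_residue_self[OF assms])
  then have "(norm ?r)\<^sup>2 \<le> norm ?r * norm (u - c *s v)"
    using Cauchy_Schwarz[of ?r "u - c *s v"] by (simp add: self norm_power)
  then show ?thesis by (cases "?r = 0") (auto simp: power2_eq_square)
qed

text \<open>The sine of the angle is the distance of a unit vector to a line, which a linear map distorts by at
  most its condition number; hence sines rather than angles below.\<close>

lemma sin_proj_dist_unit:
  assumes "norm u = 1" "norm v = 1"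
  shows "sin (proj_dist ip (vec.span {u}) (vec.span {v})) = norm (u - ip u v *s v)"
  using norm_residue[OF assms(2,1)] unit_le_1[OF assms]
  by (simp add: proj_dist_unit assms sin_arccos order_trans[of "-1" 0] real_sqrt_unique)

text \<open>Homogeneous form for vectors that are not normalized, such as images of unit vectors
  under a matrix. Any point of the second line may serve as comparison, so \<open>c\<close> is
  free.\<close>

lemma sin_proj_dist_le:
  assumes "u \<noteq> 0" "v \<noteq> 0"
  shows "norm u * sin (proj_dist ip (vec.span {u}) (vec.span {v})) \<le> norm (u - c *s v)"
proof -
  define b where "b = (of_real (inverse (norm u)) :: 'k)"
  define e where "e = (of_real (inverse (norm v)) :: 'k)"
  have b: "b \<noteq> 0" "norm (b *s u) = 1" and e: "e \<noteq> 0" "norm (e *s v) = 1"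
    using assms by (auto simp: b_def e_def norm_vector_smult norm_inverse)
  have "sin (proj_dist ip (vec.span {b *s u}) (vec.span {e *s v})) \<le> norm (b *s u - (b * c * inverse e) *s (e *s v))"
    unfolding sin_proj_dist_unit[OF b(2) e(2)] by (rule norm_residue_le[OF e(2)])
  also have "b *s u - (b * c * inverse e) *s (e *s v) = b *s (u - c *s v)"
    using e by (simp add: vec.scale_right_diff_distrib)
  finally have "sin (proj_dist ip (vec.span {u}) (vec.span {v})) \<le> norm b * norm (u - c *s v)"
    by (simp only: span_smult[OF b(1)] span_smult[OF e(1)] norm_vector_smult)
  moreover have "norm b = inverse (norm u)" by (simp add: b_def norm_inverse)
  ultimately show ?thesis
    using assms by (simp add: field_simps)
qed

text \<open>Valid for arbitrary sets: if a representative vanishes, the quotient is 0 by the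
  convention for division and the angle is \<open>pi / 2\<close>.\<close>

lemma proj_dist_bounds: "0 \<le> proj_dist ip L M" "proj_dist ip L M \<le> pi / 2"
proof -
  let ?v = "line_rep L" and ?w = "line_rep M"
  have "norm (ip ?v ?w) / (norm ?v * norm ?w) \<le> 1"
    using Cauchy_Schwarz[of ?v ?w] by (cases "?v = 0 \<or> ?w = 0") (auto simp: divide_le_eq_1)
  moreover have "0 \<le> norm (ip ?v ?w) / (norm ?v * norm ?w)" by simp
  ultimately show "0 \<le> proj_dist ip L M" "proj_dist ip L M \<le> pi / 2"
    unfolding proj_dist_def Let_def
    using arccos_lbound arccos_le_pi2 by (meson order_trans neg_le_0_iff_le zero_le_one)+
qed

lemma sin_proj_dist_nonneg: "0 \<le> sin (proj_dist ip L M)"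
  using proj_dist_bounds[of L M] by (intro sin_ge_zero) auto

lemma projective_action_Lipschitz:
  fixes A :: "'k ^ 'n ^ 'n"
  assumes A: "invertible A"
  obtains c where "c \<ge> 0" "\<And>L M. L \<in> projective_space \<Longrightarrow> M \<in> projective_space \<Longrightarrow>
    sin (proj_dist ip (projective_action A L) (projective_action A M)) \<le> c * sin (proj_dist ip L M)"
proof -
  obtain A' where A': "A' ** A = mat 1" using A by (auto simp: invertible_def)
  obtain B where B: "B > 0" "\<And>v. norm (A *v v) \<le> B * norm v" using matrix_vector_mult_bound[of A] by blast
  obtain B' where B': "B' > 0" "\<And>v. norm (A' *v v) \<le> B' * norm v" using matrix_vector_mult_bound[of A'] by blast
  show thesis
  proof
    show "B' * B \<ge> 0" using B B' by simp
    fix L M :: "('k ^ 'n) set" assume "L \<in> projective_space" "M \<in> projective_space"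
    then obtain u v where uv: "norm u = 1" "L = vec.span {u}" "norm v = 1" "M = vec.span {v}"
      using unit_line by metis
    have nz: "A *v u \<noteq> 0" "A *v v \<noteq> 0"
      using invertible_mult_vec_eq_0[OF A, of u] invertible_mult_vec_eq_0[OF A, of v] uv by auto
    let ?s = "sin (proj_dist ip (projective_action A L) (projective_action A M))"
    \<comment> \<open>\<open>A'\<close> undoes \<open>A\<close>, so the image of the unit vector
      \<open>u\<close> has norm at least \<open>1 / B'\<close>.\<close>
    have "1 \<le> B' * norm (A *v u)"
      using B'(2)[of "A *v u"] uv(1) by (simp add: matrix_vector_mul_assoc A')
    then have "1 * ?s \<le> B' * norm (A *v u) * ?s"
      by (rule mult_right_mono) (rule sin_proj_dist_nonneg)
    \<comment> \<open>\<open>ip u v\<close> is the optimal coefficient before \<open>A\<close> is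
      applied. Afterwards it is just some coefficient, which \<open>sin_proj_dist_le\<close> admits,
      and it lets \<open>A\<close> be pulled out.\<close>
    also have "\<dots> \<le> B' * norm (A *v u - ip u v *s (A *v v))"
      using sin_proj_dist_le[OF nz, of "ip u v"] B'(1)
      by (simp add: uv projective_action_span mult.assoc mult_left_mono)
    also have "A *v u - ip u v *s (A *v v) = A *v (u - ip u v *s v)"
      by (simp add: vec.diff vec.scale)
    also have "B' * norm (A *v (u - ip u v *s v)) \<le> B' * (B * sin (proj_dist ip L M))"
      using B(2)[of "u - ip u v *s v"] B'(1) by (simp add: uv sin_proj_dist_unit)
    finally show "?s \<le> B' * B * sin (proj_dist ip L M)" by simp
  qed
qed

end

section \<open>Gromov products and boundary points\<close>

lemma gromov_product_commute: "gromov_product dist w x y = gromov_product dist w y x"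
  by (simp add: gromov_product_def dist_commute)

lemma gromov_product_nonneg: "0 \<le> gromov_product dist w x y"
  unfolding gromov_product_def using dist_triangle2[of x y w] by simp

lemma gromov_product_le_dist: "gromov_product dist w x y \<le> dist x w"
  unfolding gromov_product_def using dist_triangle2[of y w x] by (simp add: dist_commute)

lemma gromov_product_base_lipschitz:
  "gromov_product dist w x y \<le> gromov_product dist p x y + dist w p"
  unfolding gromov_product_def
  using dist_triangle[of x w p] dist_triangle[of y w p] by (simp add: dist_commute field_simps)

lemma gromov_product_lipschitz: "gromov_product dist w x y \<le> gromov_product dist w x z + dist y z"
  unfolding gromov_product_def
  using dist_triangle[of y w z] dist_triangle[of x z y] by (simp add: dist_commute field_simps)

lemma gromov_product_change_base:
  "gromov_product dist p x y =
    gromov_product dist w x y + dist p w - gromov_product dist w x p - gromov_product dist w y p"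
  by (simp add: gromov_product_def field_simps)

section \<open>Boundary points and the boundary product\<close>

lemma asymptotic_iff:
  "asymptotic w s t \<longleftrightarrow> (\<forall>c. \<exists>N. \<forall>m\<ge>N. \<forall>n\<ge>N. gromov_product dist w (s m) (t n) \<ge> c)"
  unfolding asymptotic_def filterlim_at_top eventually_prod_sequentially by simp blast

lemma mem_gromov_boundary_iff:
  "x \<in> gromov_boundary w \<longleftrightarrow>
    (\<exists>s\<in>gromov_sequences w. x = {t \<in> gromov_sequences w. asymptotic w s t})"
  unfolding gromov_boundary_def quotient_def by auto

lemma gromov_boundary_rep:
  assumes "x \<in> gromov_boundary w"
  obtains s where "s \<in> x" "s \<in> gromov_sequences w" "\<And>t. t \<in> x \<Longrightarrow> asymptotic w s t"
    "x = {t \<in> gromov_sequences w. asymptotic w s t}"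
  using assms unfolding mem_gromov_boundary_iff gromov_sequences_def by blast

lemma boundary_product_nonneg:
  assumes "x \<in> gromov_boundary w" "y \<in> gromov_boundary w"
  shows "0 \<le> boundary_product w x y"
proof -
  obtain s t where "s \<in> x" "t \<in> y" using assms gromov_boundary_rep by metis
  moreover have "0 \<le> Liminf (sequentially \<times>\<^sub>F sequentially) (\<lambda>(m, n). ereal (gromov_product dist w (s m) (t n)))"
    by (rule Liminf_bounded) (simp add: gromov_product_nonneg split_def)
  ultimately show ?thesis
    unfolding boundary_product_def by (auto intro: SUP_upper2)
qed

lemma boundary_product_ge:
  assumes "s \<in> x" "t \<in> y" "\<And>m n. m \<ge> N \<Longrightarrow> n \<ge> N \<Longrightarrow> c \<le> gromov_product dist w (s m) (t n)"
  shows "ereal c \<le> boundary_product w x y"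
proof -
  have "ereal c \<le> Liminf (sequentially \<times>\<^sub>F sequentially) (\<lambda>(m, n). ereal (gromov_product dist w (s m) (t n)))"
    by (rule Liminf_bounded) (use assms(3) in \<open>auto simp: eventually_prod_sequentially\<close>)
  then show ?thesis
    unfolding boundary_product_def using assms(1,2) by (auto intro: SUP_upper2)
qed

lemma boundary_product_less_frequently:
  assumes "s \<in> x" "t \<in> y" "boundary_product w x y < ereal c"
  obtains m n where "m \<ge> N" "n \<ge> N" "gromov_product dist w (s m) (t n) < c"
proof (rule ccontr)
  assume "\<not> thesis"
  with that have "c \<le> gromov_product dist w (s m) (t n)" if "m \<ge> N" "n \<ge> N" for m n
    by (meson not_le that)
  then show False
    using boundary_product_ge[OF assms(1,2)] assms(3) leD by blast
qed

text \<open>A lower limit above \<open>c\<close> would force all products above \<open>c\<close>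
  from some index on, so one late pair of indices beyond each \<open>N\<close> is enough.\<close>

lemma boundary_product_le:
  assumes "\<And>s t N. s \<in> x \<Longrightarrow> t \<in> y \<Longrightarrow> \<exists>m\<ge>N. \<exists>n\<ge>N. gromov_product dist w (s m) (t n) \<le> c"
  shows "boundary_product w x y \<le> ereal c"
  unfolding boundary_product_def
proof (rule SUP_least, clarify)
  fix s t assume st: "s \<in> x" "t \<in> y"
  show "Liminf (sequentially \<times>\<^sub>F sequentially) (\<lambda>(m, n). ereal (gromov_product dist w (s m) (t n))) \<le> ereal c"
  proof (rule ccontr)
    assume "\<not> ?thesis"
    then have "eventually (\<lambda>(m, n). ereal c < ereal (gromov_product dist w (s m) (t n))) (sequentially \<times>\<^sub>F sequentially)"
      by (auto dest!: less_LiminfD simp: not_le split_def)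
    then show False
      using assms[OF st] by (fastforce simp: eventually_prod_sequentially)
  qed
qed

lemma exp_neg_le:
  assumes "a > 1" "ereal c \<le> t"
  shows "exp_neg a t \<le> a powr - c"
  using assms by (cases t) (auto simp: exp_neg_def)

text \<open>The assumption \<open>0 \<le> t\<close> excludes -\<infinity>, at which
  \<open>exp_neg\<close> takes the default value 1.\<close>

lemma exp_neg_ge:
  assumes "a > 1" "0 \<le> t" "t \<le> ereal c"
  shows "a powr - c \<le> exp_neg a t"
  using assms by (cases t) (auto simp: exp_neg_def)

section \<open>Rays, branch points and compactness of the boundary\<close>

locale geodesic_hyperbolic =
  fixes x\<^sub>0 :: "'x::metric_space" and \<delta> :: real
  assumes geodesic: "geodesic_space TYPE('x)"
    and delta_nonneg: "0 \<le> \<delta>"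
    and hyperbolic: "\<And>w x y z :: 'x. gromov_product dist w x z
      \<ge> min (gromov_product dist w x y) (gromov_product dist w y z) - \<delta>"
begin

abbreviation gp :: "'x \<Rightarrow> 'x \<Rightarrow> real" where "gp \<equiv> gromov_product dist x\<^sub>0"

text \<open>The point at distance \<open>t\<close> on a geodesic from the base point to a far away member of \<open>s\<close>
  plays the role of a point on a geodesic ray to the boundary point of \<open>s\<close>.\<close>

lemma ray_point:
  assumes s: "s \<in> gromov_sequences x\<^sub>0" and t: "0 \<le> t"
  obtains p where "dist x\<^sub>0 p = t"
    "\<And>s'. asymptotic x\<^sub>0 s s' \<Longrightarrow> \<exists>N. \<forall>n\<ge>N. gp (s' n) p \<ge> t - 2 * \<delta>"
proof -
  obtain M where M: "\<And>m n. m \<ge> M \<Longrightarrow> n \<ge> M \<Longrightarrow> gp (s m) (s n) \<ge> t"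
    using s unfolding gromov_sequences_def asymptotic_iff by blast
  obtain c where c: "c 0 = x\<^sub>0" "c (dist x\<^sub>0 (s M)) = s M"
    "\<And>u v. u \<in> {0..dist x\<^sub>0 (s M)} \<Longrightarrow> v \<in> {0..dist x\<^sub>0 (s M)} \<Longrightarrow> dist (c u) (c v) = \<bar>u - v\<bar>"
    using geodesic unfolding geodesic_space_def by blast
  have d: "t \<le> dist x\<^sub>0 (s M)" using M[of M M] gromov_product_le_dist[of x\<^sub>0 "s M" "s M"] by (simp add: dist_commute)
  have p: "dist x\<^sub>0 (c t) = t" "dist (s M) (c t) = dist x\<^sub>0 (s M) - t"
    using c(1) c(2) c(3)[of 0 t] c(3)[of "dist x\<^sub>0 (s M)" t] t d by auto
  \<comment> \<open>\<open>c t\<close> lies on a geodesic from the base point to \<open>s M\<close>,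
    so the product is its full distance \<open>t\<close>.\<close>
  have sp: "gp (s M) (c t) = t" using p by (simp add: gromov_product_def dist_commute)
  show thesis
  proof
    show "dist x\<^sub>0 (c t) = t" by fact
    fix s' assume "asymptotic x\<^sub>0 s s'"
    then obtain N where N: "\<And>m n. m \<ge> N \<Longrightarrow> n \<ge> N \<Longrightarrow> gp (s m) (s' n) \<ge> t"
      unfolding asymptotic_iff by blast
    have "gp (s' n) (c t) \<ge> t - 2 * \<delta>" if "n \<ge> N" for n
    proof -
      \<comment> \<open>Hyperbolicity is used twice, each time at the cost of
        \<open>\<delta>\<close>: from \<open>s' n\<close> through \<open>s ?k\<close> to
        \<open>s M\<close>, then through \<open>s M\<close> to \<open>c t\<close>.\<close>
      let ?k = "max M N"
      have "gp (s' n) (s M) \<ge> t - \<delta>"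
        using hyperbolic[of x\<^sub>0 "s' n" "s ?k" "s M"] N[of ?k n] M[of ?k M] that
        by (simp add: gromov_product_commute[of x\<^sub>0 "s' n"] min_def split: if_splits)
      then show ?thesis
        using hyperbolic[of x\<^sub>0 "s' n" "s M" "c t"] sp delta_nonneg by (simp add: min_def split: if_splits)
    qed
    then show "\<exists>N. \<forall>n\<ge>N. gp (s' n) (c t) \<ge> t - 2 * \<delta>" by blast
  qed
qed

text \<open>\<open>p\<close> is roughly where rays to \<open>x\<close> and \<open>y\<close>
  separate. The boundary product is a supremum of lower limits, so representatives have product
  below \<open>t + 1\<close> only at arbitrarily late pairs of indices; hence the form of the
  conclusion.\<close>

lemma branch_point:
  assumes x: "x \<in> gromov_boundary x\<^sub>0" and y: "y \<in> gromov_boundary x\<^sub>0"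
    and t: "boundary_product x\<^sub>0 x y = ereal t"
  obtains p where "dist x\<^sub>0 p = t"
    "\<And>s u N. s \<in> x \<Longrightarrow> u \<in> y \<Longrightarrow> \<exists>m\<ge>N. \<exists>n\<ge>N. gromov_product dist p (s m) (u n) \<le> 5 * \<delta> + 1"
proof -
  have t0: "0 \<le> t" using boundary_product_nonneg[OF x y] t by simp
  obtain s0 where s0: "s0 \<in> gromov_sequences x\<^sub>0" "\<And>t. t \<in> x \<Longrightarrow> asymptotic x\<^sub>0 s0 t"
    using x gromov_boundary_rep by metis
  obtain p where p: "dist x\<^sub>0 p = t"
    "\<And>s'. asymptotic x\<^sub>0 s0 s' \<Longrightarrow> \<exists>N. \<forall>n\<ge>N. gp (s' n) p \<ge> t - 2 * \<delta>"
    using ray_point[OF s0(1) t0] by metis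
  show thesis
  proof
    show "dist x\<^sub>0 p = t" by fact
    fix s u N assume su: "s \<in> x" "u \<in> y"
    obtain K where K: "\<And>n. n \<ge> K \<Longrightarrow> gp (s n) p \<ge> t - 2 * \<delta>" using p(2) s0(2)[OF su(1)] by blast
    have "boundary_product x\<^sub>0 x y < ereal (t + 1)" using t by simp
    then obtain m n where mn: "m \<ge> max K N" "n \<ge> max K N" "gp (s m) (u n) < t + 1"
      using boundary_product_less_frequently[OF su] by metis
    \<comment> \<open>If the minimum is \<open>gp (s m) p\<close>, both products with
      \<open>p\<close> are at least \<open>t - 3 * \<delta>\<close> and the change of base gives
      \<open>5 * \<delta> + 1\<close>. Otherwise \<open>gp (s m) (u n)\<close> cancels and
      \<open>3 * \<delta>\<close> remains.\<close>
    have "gp (u n) p \<ge> min (gp (s m) (u n)) (gp (s m) p) - \<delta>"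
      using hyperbolic[of x\<^sub>0 "u n" "s m" p] by (simp add: gromov_product_commute[of x\<^sub>0 "u n"])
    then have "gromov_product dist p (s m) (u n) \<le> 5 * \<delta> + 1"
      using gromov_product_change_base[of p "s m" "u n" x\<^sub>0] K[of m] mn p(1) delta_nonneg
      by (simp add: dist_commute min_def split: if_splits)
    then show "\<exists>m\<ge>N. \<exists>n\<ge>N. gromov_product dist p (s m) (u n) \<le> 5 * \<delta> + 1" using mn by auto
  qed
qed

text \<open>Each \<open>X n\<close> is replaced by a discrete ray \<open>P n\<close> with one point
  at each integer distance from the base point. Properness yields a pointwise limit \<open>q\<close>
  of a subsequence of rays, and \<open>q\<close> represents the limit boundary point.\<close>

lemma gromov_boundary_sequentially_compact:
  assumes proper: "proper_space TYPE('x)" and X: "\<And>n. X n \<in> gromov_boundary x\<^sub>0"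
  shows "\<exists>x\<in>gromov_boundary x\<^sub>0. \<exists>r :: nat \<Rightarrow> nat. strict_mono r \<and>
    (\<forall>c. eventually (\<lambda>n. ereal c \<le> boundary_product x\<^sub>0 (X (r n)) x) sequentially)"
proof -
  have "\<exists>s. s \<in> X n \<and> s \<in> gromov_sequences x\<^sub>0" for n
    using X gromov_boundary_rep by metis
  then obtain S where S: "\<And>n. S n \<in> X n" "\<And>n. S n \<in> gromov_sequences x\<^sub>0" by metis
  define Q where "Q n k p \<longleftrightarrow> dist x\<^sub>0 p = real k \<and> (\<exists>N. \<forall>m\<ge>N. gp (S n m) p \<ge> real k - 2 * \<delta>)" for n k p
  have "\<exists>p. Q n k p" for n k
  proof -
    obtain p where p: "dist x\<^sub>0 p = real k"
      "\<And>s'. asymptotic x\<^sub>0 (S n) s' \<Longrightarrow> \<exists>N. \<forall>m\<ge>N. gp (s' m) p \<ge> real k - 2 * \<delta>"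
      by (rule ray_point[OF S(2)[of n], of "real k"]) auto
    have "asymptotic x\<^sub>0 (S n) (S n)" using S(2)[of n] by (simp add: gromov_sequences_def)
    then show ?thesis using p unfolding Q_def by blast
  qed
  then obtain P where "\<And>n k. Q n k (P n k)" by metis
  then have P: "\<And>n k. dist x\<^sub>0 (P n k) = real k"
    "\<And>n k. \<exists>N. \<forall>m\<ge>N. gp (S n m) (P n k) \<ge> real k - 2 * \<delta>" unfolding Q_def by blast+
  \<comment> \<open>Both points are compared with one late member of \<open>S n\<close>:
    \<open>2 * \<delta>\<close> from the rays and \<open>\<delta>\<close> from
    hyperbolicity.\<close>
  have PP: "gp (P n k) (P n l) \<ge> real (min k l) - 3 * \<delta>" for n k l
  proof -
    obtain N where N: "\<And>m. m \<ge> N \<Longrightarrow> gp (S n m) (P n k) \<ge> real k - 2 * \<delta>" using P(2) by blast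
    obtain N' where N': "\<And>m. m \<ge> N' \<Longrightarrow> gp (S n m) (P n l) \<ge> real l - 2 * \<delta>" using P(2) by blast
    show ?thesis
      using hyperbolic[of x\<^sub>0 "P n k" "S n (max N N')" "P n l"] N[of "max N N'"] N'[of "max N N'"]
      by (simp add: gromov_product_commute[of x\<^sub>0 "P n k"] min_def split: if_splits)
  qed
  \<comment> \<open>Tychonoff replaces a diagonal argument: a countable product of closed balls is
    compact and metrizable, so one subsequence converges in all coordinates.\<close>
  have "compactin (product_topology (\<lambda>_. euclidean) UNIV) (PiE UNIV (\<lambda>k::nat. cball x\<^sub>0 (real k)))"
    using proper unfolding compactin_PiE proper_space_def by simp
  then have "seq_compact (PiE UNIV (\<lambda>k::nat. cball x\<^sub>0 (real k)))"
    by (simp add: euclidean_product_topology compact_eq_seq_compact_metric)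
  moreover have "\<forall>n. P n \<in> PiE UNIV (\<lambda>k::nat. cball x\<^sub>0 (real k))" using P(1) by auto
  ultimately obtain q r where r: "strict_mono (r :: nat \<Rightarrow> nat)" and q: "(P \<circ> r) \<longlonglongrightarrow> q"
    by (meson seq_compactE)
  have lim: "(\<lambda>n. P (r n) k) \<longlonglongrightarrow> q k" for k
  proof -
    have "isCont (\<lambda>f :: nat \<Rightarrow> 'x. f k) q"
      using continuous_on_product_coordinates[of k] continuous_on_eq_continuous_at[OF open_UNIV] by blast
    then show ?thesis using isCont_tendsto_compose[OF _ q] by (simp add: o_def)
  qed
  have qq: "gp (q k) (q l) \<ge> real (min k l) - 3 * \<delta>" for k l
  proof (rule tendsto_lowerbound)
    show "(\<lambda>n. gp (P (r n) k) (P (r n) l)) \<longlonglongrightarrow> gp (q k) (q l)"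
      unfolding gromov_product_def by (intro tendsto_intros lim) auto
  qed (use PP in auto)
  have as: "asymptotic x\<^sub>0 q q"
    unfolding asymptotic_iff
  proof
    fix c
    obtain N :: nat where N: "real N \<ge> c + 3 * \<delta>" using real_arch_simple by blast
    have "gp (q m) (q n) \<ge> c" if "m \<ge> N" "n \<ge> N" for m n
    proof -
      have "real (min m n) \<ge> real N" using that by simp
      then show ?thesis using qq[of m n] N by linarith
    qed
    then show "\<exists>N. \<forall>m\<ge>N. \<forall>n\<ge>N. gp (q m) (q n) \<ge> c" by blast
  qed
  define x where "x = {t \<in> gromov_sequences x\<^sub>0. asymptotic x\<^sub>0 q t}"
  have qx: "q \<in> x" using as by (simp add: x_def gromov_sequences_def)
  show ?thesis
  proof (intro bexI exI conjI allI)
    show "x \<in> gromov_boundary x\<^sub>0"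
      using as unfolding mem_gromov_boundary_iff x_def gromov_sequences_def by blast
    show "strict_mono r" by fact
    fix c
    \<comment> \<open>The excess over \<open>c\<close> covers all losses on the way from
      \<open>S (r n) m\<close> through \<open>P (r n) k\<close> and \<open>q k\<close> to
      \<open>q l\<close>; the 1 pays for the move from \<open>P (r n) k\<close> to
      \<open>q k\<close>.\<close>
    obtain k :: nat where k: "real k \<ge> c + 5 * \<delta> + 1" using real_arch_simple by blast
    have "eventually (\<lambda>n. dist (P (r n) k) (q k) < 1) sequentially"
      using tendstoD[OF lim] by simp
    then show "eventually (\<lambda>n. ereal c \<le> boundary_product x\<^sub>0 (X (r n)) x) sequentially"
    proof eventually_elim
      case (elim n)
      obtain N where N: "\<And>m. m \<ge> N \<Longrightarrow> gp (S (r n) m) (P (r n) k) \<ge> real k - 2 * \<delta>" using P(2) by blast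
      show ?case
      proof (rule boundary_product_ge[OF S(1) qx])
        \<comment> \<open>\<open>l \<ge> k\<close> makes \<open>min k l\<close> equal to
          \<open>k\<close> in \<open>qq\<close>.\<close>
        fix m l assume "m \<ge> max N k" "l \<ge> max N k"
        then have 1: "gp (S (r n) m) (P (r n) k) \<ge> real k - 2 * \<delta>" and 2: "gp (q k) (q l) \<ge> real k - 3 * \<delta>"
          using N qq[of k l] by (auto simp: min_def)
        have "gp (S (r n) m) (q k) \<ge> real k - 2 * \<delta> - 1"
          using 1 elim gromov_product_lipschitz[of x\<^sub>0 "S (r n) m" "P (r n) k" "q k"] by linarith
        then show "c \<le> gp (S (r n) m) (q l)"
          using 2 k hyperbolic[of x\<^sub>0 "S (r n) m" "q k" "q l"] delta_nonneg by linarith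
      qed
    qed
  qed
qed

text \<open>The upper visual bound turns boundary products tending to infinity into convergence for
  \<open>d\<close>.\<close>

lemma compact_space_visual:
  assumes proper: "proper_space TYPE('x)" and a: "a > 1" and vis: "visual_metric x\<^sub>0 a d"
  shows "compact_space (Metric_space.mtopology (gromov_boundary x\<^sub>0) d)"
proof -
  interpret V: Metric_space "gromov_boundary x\<^sub>0" d using vis by (simp add: visual_metric_def)
  obtain b where b: "b > 1" "\<And>x y. x \<in> gromov_boundary x\<^sub>0 \<Longrightarrow> y \<in> gromov_boundary x\<^sub>0 \<Longrightarrow>
      d x y \<le> b * exp_neg a (boundary_product x\<^sub>0 x y)"
    using vis unfolding visual_metric_def by (elim conjE exE) simp
  show ?thesis
    unfolding V.compact_space_sequentially
  proof (intro allI impI)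
    fix X :: "nat \<Rightarrow> _" assume "range X \<subseteq> gromov_boundary x\<^sub>0"
    then have X: "\<And>n. X n \<in> gromov_boundary x\<^sub>0" by auto
    obtain x r where x: "x \<in> gromov_boundary x\<^sub>0" and r: "strict_mono (r :: nat \<Rightarrow> nat)"
      and lim: "\<And>c. eventually (\<lambda>n. ereal c \<le> boundary_product x\<^sub>0 (X (r n)) x) sequentially"
      using gromov_boundary_sequentially_compact[of X, OF proper X] by blast
    have "limitin V.mtopology (X \<circ> r) x sequentially"
      unfolding V.limitin_metric
    proof (intro conjI allI impI x)
      fix e :: real assume e: "e > 0"
      define c where "c = - log a (e / (2 * b))"
      have "a powr - c = e / (2 * b)" using a b e by (simp add: c_def)
      then have small: "b * a powr - c < e" using b e by simp
      show "eventually (\<lambda>n. (X \<circ> r) n \<in> gromov_boundary x\<^sub>0 \<and> d ((X \<circ> r) n) x < e) sequentially"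
        using lim[of c]
      proof eventually_elim
        case (elim n)
        have "d (X (r n)) x \<le> b * a powr - c"
          using b(2)[OF X x, of "r n"] exp_neg_le[OF a elim] b(1)
          by (meson mult_left_mono order_trans less_imp_le zero_less_one)
        then show ?case using small X by simp
      qed
    qed
    then show "\<exists>l r. l \<in> gromov_boundary x\<^sub>0 \<and> strict_mono r \<and> limitin V.mtopology (X \<circ> r) l sequentially"
      using x r by blast
  qed
qed

end

section \<open>The action of the group\<close>

locale model_space_action =
  fixes G :: "('g, 'b) monoid_scheme" (structure)
    and \<phi> :: "'g \<Rightarrow> 'x::metric_space \<Rightarrow> 'x" and x\<^sub>0 :: 'x
  assumes model: "model_space G \<phi>"
begin

lemma is_group_action: "group_action G UNIV \<phi>"
  using model by (simp add: model_space_def)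

lemma is_group: "group G"
  using is_group_action by (simp add: group_action_def group_hom_def)

lemma action_isometry: "g \<in> carrier G \<Longrightarrow> dist (\<phi> g x) (\<phi> g y) = dist x y"
  using model by (simp add: model_space_def)

lemma action_inv: "g \<in> carrier G \<Longrightarrow> \<phi> (inv g) (\<phi> g x) = x"
  using group_action.orbit_sym_aux[OF is_group_action] by auto

lemma action_inv': "g \<in> carrier G \<Longrightarrow> \<phi> g (\<phi> (inv g) x) = x"
  using action_inv[of "inv g"] is_group by simp

lemma action_mult: "g \<in> carrier G \<Longrightarrow> h \<in> carrier G \<Longrightarrow> \<phi> (g \<otimes> h) x = \<phi> g (\<phi> h x)"
  using group_action.composition_rule[OF is_group_action] by auto

section \<open>Orbits and exponential growth\<close>

lemma orbit_cobounded:
  obtains D where "D \<ge> 0" "\<And>z. \<exists>g\<in>carrier G. dist (\<phi> g x\<^sub>0) z \<le> D"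
proof -
  obtain K where K: "compact K" "(\<Union>g\<in>carrier G. \<phi> g ` K) = UNIV"
    using model unfolding model_space_def by blast
  obtain R where R: "\<And>k. k \<in> K \<Longrightarrow> dist x\<^sub>0 k \<le> R"
    using compact_imp_bounded[OF K(1)] bounded_any_center[of K x\<^sub>0] by blast
  show thesis
  proof
    show "max R 0 \<ge> 0" by simp
    fix z
    obtain g k where g: "g \<in> carrier G" "k \<in> K" "z = \<phi> g k" using K(2) by blast
    then have "dist (\<phi> g x\<^sub>0) z \<le> max R 0" using action_isometry[of g] R[of k] by simp
    with g show "\<exists>g\<in>carrier G. dist (\<phi> g x\<^sub>0) z \<le> max R 0" by blast
  qed
qed

lemma finite_displacement: "finite {g \<in> carrier G. dist (\<phi> g x\<^sub>0) x\<^sub>0 \<le> R}"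
proof -
  have "compact (cball x\<^sub>0 (max R 0))" using model by (simp add: model_space_def proper_space_def)
  then have "finite {g \<in> carrier G. \<phi> g ` cball x\<^sub>0 (max R 0) \<inter> cball x\<^sub>0 (max R 0) \<noteq> {}}"
    using model unfolding model_space_def by blast
  moreover have "\<phi> g ` cball x\<^sub>0 (max R 0) \<inter> cball x\<^sub>0 (max R 0) \<noteq> {}" if "dist (\<phi> g x\<^sub>0) x\<^sub>0 \<le> R" for g
  proof -
    have "\<phi> g x\<^sub>0 \<in> \<phi> g ` cball x\<^sub>0 (max R 0) \<inter> cball x\<^sub>0 (max R 0)"
      using that by (auto simp: dist_commute)
    then show ?thesis by blast
  qed
  ultimately show ?thesis by (auto intro: finite_subset[rotated])
qed

text \<open>The path-subdivision argument of the Schwarz--Milnor lemma: a submultiplicative quantity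
  grows at most exponentially in the displacement of the base point.\<close>

lemma exponential_growth:
  fixes P :: "'g \<Rightarrow> real \<Rightarrow> bool"
  assumes ex: "\<And>g. g \<in> carrier G \<Longrightarrow> \<exists>c. P g c"
    and mono: "\<And>g b c. P g b \<Longrightarrow> b \<le> c \<Longrightarrow> P g c"
    and mult: "\<And>g h b c. g \<in> carrier G \<Longrightarrow> h \<in> carrier G \<Longrightarrow> P g b \<Longrightarrow> P h c \<Longrightarrow> P (g \<otimes> h) (b * c)"
  obtains L where "L \<ge> B" "\<And>g n. g \<in> carrier G \<Longrightarrow> dist (\<phi> g x\<^sub>0) x\<^sub>0 \<le> real n \<Longrightarrow> P g (L ^ Suc n)"
proof -
  interpret group G by (rule is_group)
  obtain D where D: "D \<ge> 0" "\<And>z. \<exists>g\<in>carrier G. dist (\<phi> g x\<^sub>0) z \<le> D" by (rule orbit_cobounded) blast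
  \<comment> \<open>\<open>2 * D + 1\<close> bounds the displacement between two orbit points that
    are \<open>D\<close>-close to points at distance at most 1.\<close>
  define F where "F = {g \<in> carrier G. dist (\<phi> g x\<^sub>0) x\<^sub>0 \<le> 2 * D + 1}"
  have F: "finite F" unfolding F_def by (rule finite_displacement)
  have geodesic: "geodesic_space TYPE('x)" using model by (simp add: model_space_def)
  obtain c where c: "\<And>g. g \<in> carrier G \<Longrightarrow> P g (c g)" using ex by metis
  \<comment> \<open>Inserting \<open>B\<close> lets a lower bound for \<open>L\<close> be
    prescribed.\<close>
  define L where "L = Max (insert B (c ` F))"
  have "B \<le> L" unfolding L_def using F by (intro Max_ge) auto
  have LF: "P g L" if "g \<in> F" for g
  proof (rule mono)
    show "P g (c g)" using that c by (simp add: F_def)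
    show "c g \<le> L" unfolding L_def using F that by (intro Max_ge) auto
  qed
  \<comment> \<open>The induction follows a point \<open>z\<close> near the orbit point, since
    points of a geodesic need not lie in the orbit. At \<open>n = 0\<close> the element
    \<open>g\<close> is only known to be in \<open>F\<close>, which costs one factor; hence
    \<open>Suc n\<close>.\<close>
  have step: "P g (L ^ Suc n)"
    if "g \<in> carrier G" "dist x\<^sub>0 z \<le> real n" "dist (\<phi> g x\<^sub>0) z \<le> D" for g z n
    using that
  proof (induction n arbitrary: g z)
    case 0
    then have "g \<in> F" using D(1) by (simp add: F_def dist_commute)
    then show ?case using LF by simp
  next
    case (Suc n)
    \<comment> \<open>One unit back along a geodesic from the base point to \<open>z\<close>,
      stopping at the base point.\<close>
    obtain z' where z': "dist x\<^sub>0 z' \<le> real n" "dist z' z \<le> 1"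
    proof -
      obtain p where p: "p 0 = x\<^sub>0" "p (dist x\<^sub>0 z) = z"
        "\<And>u v. u \<in> {0..dist x\<^sub>0 z} \<Longrightarrow> v \<in> {0..dist x\<^sub>0 z} \<Longrightarrow> dist (p u) (p v) = \<bar>u - v\<bar>"
        using geodesic unfolding geodesic_space_def by blast
      let ?t = "max 0 (dist x\<^sub>0 z - 1)"
      have t: "?t \<in> {0..dist x\<^sub>0 z}" by auto
      have "dist x\<^sub>0 (p ?t) = ?t" "dist (p ?t) z = \<bar>?t - dist x\<^sub>0 z\<bar>"
        using p(3)[of 0 ?t] p(3)[of ?t "dist x\<^sub>0 z"] t p(1,2) by auto
      then show ?thesis using Suc.prems(2) that[of "p ?t"] by (auto simp: max_def split: if_splits)
    qed
    obtain h where h: "h \<in> carrier G" "dist (\<phi> h x\<^sub>0) z' \<le> D" using D(2) by blast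
    have "dist (\<phi> (inv h \<otimes> g) x\<^sub>0) x\<^sub>0 = dist (\<phi> h (\<phi> (inv h \<otimes> g) x\<^sub>0)) (\<phi> h x\<^sub>0)"
      using action_isometry[OF h(1)] by simp
    also have "\<phi> h (\<phi> (inv h \<otimes> g) x\<^sub>0) = \<phi> g x\<^sub>0"
      using h(1) Suc.prems(1) by (simp add: action_mult action_inv')
    also have "dist (\<phi> g x\<^sub>0) (\<phi> h x\<^sub>0) \<le> dist (\<phi> g x\<^sub>0) z + dist z z' + dist z' (\<phi> h x\<^sub>0)"
      using dist_triangle[of "\<phi> g x\<^sub>0" "\<phi> h x\<^sub>0" z] dist_triangle[of z "\<phi> h x\<^sub>0" z'] by linarith
    also have "\<dots> \<le> 2 * D + 1"
      using Suc.prems(3) z'(2) h(2) by (simp add: dist_commute)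
    finally have "inv h \<otimes> g \<in> F" using h(1) Suc.prems(1) by (simp add: F_def)
    then have "P (h \<otimes> (inv h \<otimes> g)) (L ^ Suc n * L)"
      using mult Suc.IH[OF h(1) z'(1) h(2)] LF h(1) Suc.prems(1) by simp
    moreover have "h \<otimes> (inv h \<otimes> g) = g" using h(1) Suc.prems(1) by (simp flip: m_assoc)
    ultimately show ?case by (simp add: mult_ac)
  qed
  show thesis
  proof
    show "B \<le> L" by fact
    show "P g (L ^ Suc n)" if "g \<in> carrier G" "dist (\<phi> g x\<^sub>0) x\<^sub>0 \<le> real n" for g n
      using step[of g "\<phi> g x\<^sub>0" n] that D(1) by (simp add: dist_commute)
  qed
qed

section \<open>The action on the boundary\<close>

lemma gromov_product_action:
  assumes "g \<in> carrier G"
  shows "gromov_product dist x\<^sub>0 (\<phi> g x) (\<phi> g y) = gromov_product dist (\<phi> (inv g) x\<^sub>0) x y"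
proof -
  have "dist (\<phi> g z) x\<^sub>0 = dist z (\<phi> (inv g) x\<^sub>0)" for z
    using action_isometry[OF assms, of z "\<phi> (inv g) x\<^sub>0"] action_inv'[OF assms] by simp
  then show ?thesis using assms by (simp add: gromov_product_def action_isometry)
qed

lemma asymptotic_action:
  assumes g: "g \<in> carrier G" and st: "asymptotic x\<^sub>0 s t"
  shows "asymptotic x\<^sub>0 (\<phi> g \<circ> s) (\<phi> g \<circ> t)"
  unfolding asymptotic_iff
proof
  fix c
  let ?d = "dist x\<^sub>0 (\<phi> (inv g) x\<^sub>0)"
  obtain N where "\<And>m n. m \<ge> N \<Longrightarrow> n \<ge> N \<Longrightarrow> gromov_product dist x\<^sub>0 (s m) (t n) \<ge> c + ?d"
    using st unfolding asymptotic_iff by blast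
  then have "c \<le> gromov_product dist x\<^sub>0 ((\<phi> g \<circ> s) m) ((\<phi> g \<circ> t) n)" if "m \<ge> N" "n \<ge> N" for m n
    using that gromov_product_base_lipschitz[of x\<^sub>0 "s m" "t n" "\<phi> (inv g) x\<^sub>0"]
    by (fastforce simp: gromov_product_action[OF g])
  then show "\<exists>N. \<forall>m\<ge>N. \<forall>n\<ge>N. c \<le> gromov_product dist x\<^sub>0 ((\<phi> g \<circ> s) m) ((\<phi> g \<circ> t) n)" by blast
qed

text \<open>Boundary points are full equivalence classes, so the image must be a whole class; acting
  by \<open>inv g\<close> gives the inclusion of the class in the image.\<close>

lemma boundary_action_closed:
  assumes g: "g \<in> carrier G" and x: "x \<in> gromov_boundary x\<^sub>0"
  shows "boundary_action \<phi> g x \<in> gromov_boundary x\<^sub>0"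
proof -
  obtain s where s: "s \<in> gromov_sequences x\<^sub>0" "x = {t \<in> gromov_sequences x\<^sub>0. asymptotic x\<^sub>0 s t}"
    using x unfolding mem_gromov_boundary_iff by blast
  have g': "inv g \<in> carrier G" using g is_group by simp
  have [simp]: "\<phi> (inv g) \<circ> (\<phi> g \<circ> t) = t" "\<phi> g \<circ> (\<phi> (inv g) \<circ> t) = t" for t
    using action_inv[OF g] action_inv'[OF g] by auto
  have gs: "\<phi> g \<circ> t \<in> gromov_sequences x\<^sub>0" "\<phi> (inv g) \<circ> t \<in> gromov_sequences x\<^sub>0"
    if "t \<in> gromov_sequences x\<^sub>0" for t
    using that asymptotic_action[OF g] asymptotic_action[OF g'] by (auto simp: gromov_sequences_def)
  have "boundary_action \<phi> g x = {t \<in> gromov_sequences x\<^sub>0. asymptotic x\<^sub>0 (\<phi> g \<circ> s) t}"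
  proof (intro Set.set_eqI iffI)
    fix t assume "t \<in> boundary_action \<phi> g x"
    then show "t \<in> {t \<in> gromov_sequences x\<^sub>0. asymptotic x\<^sub>0 (\<phi> g \<circ> s) t}"
      using gs(1) asymptotic_action[OF g] by (auto simp: boundary_action_def s(2))
  next
    fix t assume "t \<in> {t \<in> gromov_sequences x\<^sub>0. asymptotic x\<^sub>0 (\<phi> g \<circ> s) t}"
    then have "\<phi> (inv g) \<circ> t \<in> x"
      using gs(2) asymptotic_action[OF g', of "\<phi> g \<circ> s" t] by (simp add: s(2))
    then have "\<phi> g \<circ> (\<phi> (inv g) \<circ> t) \<in> boundary_action \<phi> g x"
      unfolding boundary_action_def by (rule imageI)
    then show "t \<in> boundary_action \<phi> g x" by simp
  qed
  then show ?thesis using gs(1)[OF s(1)] unfolding mem_gromov_boundary_iff by blast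
qed

text \<open>For \<open>h\<close> moving the base point to within \<open>D\<close> of the branch
  point \<open>p\<close>, the element \<open>inv h\<close> works: products of the images at
  \<open>x\<^sub>0\<close> are products of the originals at \<open>\<phi> h x\<^sub>0\<close>, which
  exceed those at \<open>p\<close> by at most \<open>D\<close>.\<close>

lemma boundary_expansion:
  assumes D: "\<And>z. \<exists>g\<in>carrier G. dist (\<phi> g x\<^sub>0) z \<le> D"
    and hyp: "geodesic_hyperbolic TYPE('x) \<delta>"
    and xy: "x \<in> gromov_boundary x\<^sub>0" "y \<in> gromov_boundary x\<^sub>0" "boundary_product x\<^sub>0 x y = ereal t"
  obtains g where "g \<in> carrier G" "dist (\<phi> g x\<^sub>0) x\<^sub>0 \<le> t + D"
    "boundary_product x\<^sub>0 (boundary_action \<phi> g x) (boundary_action \<phi> g y) \<le> ereal (5 * \<delta> + 1 + D)"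
proof -
  obtain p where p: "dist x\<^sub>0 p = t"
    "\<And>s u N. s \<in> x \<Longrightarrow> u \<in> y \<Longrightarrow> \<exists>m\<ge>N. \<exists>n\<ge>N. gromov_product dist p (s m) (u n) \<le> 5 * \<delta> + 1"
    by (rule geodesic_hyperbolic.branch_point[OF hyp xy]) blast
  obtain h where h: "h \<in> carrier G" "dist (\<phi> h x\<^sub>0) p \<le> D" using D by blast
  have g: "inv h \<in> carrier G" "inv (inv h) = h" using h(1) is_group by auto
  show thesis
  proof
    show "inv h \<in> carrier G" by fact
    have "dist (\<phi> (inv h) x\<^sub>0) x\<^sub>0 = dist x\<^sub>0 (\<phi> h x\<^sub>0)"
      using action_isometry[OF h(1), of "\<phi> (inv h) x\<^sub>0" x\<^sub>0] action_inv'[OF h(1)] by simp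
    then show "dist (\<phi> (inv h) x\<^sub>0) x\<^sub>0 \<le> t + D"
      using dist_triangle2[of x\<^sub>0 "\<phi> h x\<^sub>0" p] p(1) h(2) by linarith
    show "boundary_product x\<^sub>0 (boundary_action \<phi> (inv h) x) (boundary_action \<phi> (inv h) y) \<le> ereal (5 * \<delta> + 1 + D)"
    proof (rule boundary_product_le)
      fix s' u' N assume "s' \<in> boundary_action \<phi> (inv h) x" "u' \<in> boundary_action \<phi> (inv h) y"
      then obtain s u where su: "s \<in> x" "u \<in> y" "s' = \<phi> (inv h) \<circ> s" "u' = \<phi> (inv h) \<circ> u"
        by (auto simp: boundary_action_def)
      obtain m n where mn: "m \<ge> N" "n \<ge> N" "gromov_product dist p (s m) (u n) \<le> 5 * \<delta> + 1"
        using p(2)[OF su(1,2)] by blast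
      have "gromov_product dist x\<^sub>0 (s' m) (u' n) \<le> 5 * \<delta> + 1 + D"
        using gromov_product_base_lipschitz[of "\<phi> h x\<^sub>0" "s m" "u n" p] mn(3) h(2)
        by (simp add: su(3,4) gromov_product_action[OF g(1)] g(2))
      then show "\<exists>m\<ge>N. \<exists>n\<ge>N. gromov_product dist x\<^sub>0 (s' m) (u' n) \<le> 5 * \<delta> + 1 + D"
        using mn by blast
    qed
  qed
qed

end

section \<open>Equivariant maps to projective space\<close>

text \<open>Taking roots of order \<open>b\<close> gives the exponent \<open>1 / b\<close>, which is
  at most 1 because \<open>b \<ge> 1\<close>.\<close>

lemma hoelder_continuous_on_inv_into:
  assumes inj: "inj_on f M" and c: "c > 0" and b: "b \<ge> 1" and d: "\<And>x y. d x y \<ge> 0"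
    and le: "\<And>x y. x \<in> M \<Longrightarrow> y \<in> M \<Longrightarrow> c * d x y powr b \<le> d' (f x) (f y)"
  shows "hoelder_continuous_on (f ` M) d' d (inv_into M f)"
  unfolding hoelder_continuous_on_def
proof (intro exI conjI ballI)
  show "0 < inverse c powr (1 / b)" "0 < 1 / b" "1 / b \<le> 1" using b c by auto
  fix u v assume "u \<in> f ` M" "v \<in> f ` M"
  then obtain x y where xy: "x \<in> M" "y \<in> M" "u = f x" "v = f y" by blast
  have "d x y powr b \<le> inverse c * d' u v"
    using le[OF xy(1,2)] c by (simp add: xy field_simps)
  then have "(d x y powr b) powr (1 / b) \<le> (inverse c * d' u v) powr (1 / b)"
    using b by (intro powr_mono2) auto
  also have "(d x y powr b) powr (1 / b) = d x y" using b d by (simp add: powr_powr)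
  also have "(inverse c * d' u v) powr (1 / b) = inverse c powr (1 / b) * d' u v powr (1 / b)"
    by (rule powr_mult)
  finally show "d (inv_into M f u) (inv_into M f v) \<le> inverse c powr (1 / b) * d' u v powr (1 / b)"
    using xy inj by simp
qed

text \<open>An abstract scalar product lets the real and complex cases share one proof.\<close>

lemma (in scalar_product) equivariant_map_lower_bound:
  fixes G :: "('g, 'b) monoid_scheme" and \<phi> :: "'g \<Rightarrow> 'x::metric_space \<Rightarrow> 'x" and x\<^sub>0 :: 'x
    and \<rho> :: "'g \<Rightarrow> 'k ^ 'n ^ 'n"
  assumes model: "model_space G \<phi>" and a: "a > 1" and vis: "visual_metric x\<^sub>0 a d"
    and hom: "\<rho> \<in> hom G GL"
    and cont: "continuous_map (Metric_space.mtopology (gromov_boundary x\<^sub>0) d)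
      (Metric_space.mtopology projective_space (proj_dist ip)) \<xi>"
    and equiv: "\<And>g x. g \<in> carrier G \<Longrightarrow> x \<in> gromov_boundary x\<^sub>0 \<Longrightarrow>
      \<xi> (boundary_action \<phi> g x) = projective_action (\<rho> g) (\<xi> x)"
    and inj: "inj_on \<xi> (gromov_boundary x\<^sub>0)"
  obtains c b where "c > 0" "b \<ge> 1" "\<And>x y. x \<in> gromov_boundary x\<^sub>0 \<Longrightarrow> y \<in> gromov_boundary x\<^sub>0 \<Longrightarrow>
    c * d x y powr b \<le> proj_dist ip (\<xi> x) (\<xi> y)"
proof -
  let ?B = "gromov_boundary x\<^sub>0"
  interpret model_space_action G \<phi> x\<^sub>0 by standard fact
  interpret V: Metric_space ?B d using vis by (simp add: visual_metric_def)
  interpret Q: Metric_space "projective_space :: ('k ^ 'n) set set" "proj_dist ip"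
    by (rule metric_projective_space)
  obtain r where r: "r > 1" "\<And>x y. x \<in> ?B \<Longrightarrow> y \<in> ?B \<Longrightarrow> inverse r * exp_neg a (boundary_product x\<^sub>0 x y) \<le> d x y"
      "\<And>x y. x \<in> ?B \<Longrightarrow> y \<in> ?B \<Longrightarrow> d x y \<le> r * exp_neg a (boundary_product x\<^sub>0 x y)"
    using vis unfolding visual_metric_def by (elim conjE exE) simp
  obtain \<delta> where "0 \<le> \<delta>" "\<And>w x y z :: 'x. gromov_product dist w x z
      \<ge> min (gromov_product dist w x y) (gromov_product dist w y z) - \<delta>"
    using model unfolding model_space_def gromov_hyperbolic_def by auto
  then have hyp: "geodesic_hyperbolic TYPE('x) \<delta>"
    using model by unfold_locales (auto simp: model_space_def)
  interpret geodesic_hyperbolic x\<^sub>0 \<delta> by (rule hyp)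
  obtain D where D: "D \<ge> 0" "\<And>z. \<exists>g\<in>carrier G. dist (\<phi> g x\<^sub>0) z \<le> D" by (rule orbit_cobounded) blast
  \<comment> \<open>\<open>c\<close> is a Lipschitz constant of \<open>\<rho> g\<close> for sines;
    its nonnegativity is what lets such constants multiply.\<close>
  define P where "P g c \<longleftrightarrow> 0 \<le> c \<and> (\<forall>L\<in>projective_space. \<forall>M\<in>projective_space.
    sin (proj_dist ip (projective_action (\<rho> g) L) (projective_action (\<rho> g) M)) \<le> c * sin (proj_dist ip L M))"
    for g c
  have inv: "invertible (\<rho> g)" if "g \<in> carrier G" for g
    using hom_in_carrier[OF hom that] by (simp add: GL_def)
  obtain L where L: "L \<ge> a" "\<And>g n. g \<in> carrier G \<Longrightarrow> dist (\<phi> g x\<^sub>0) x\<^sub>0 \<le> real n \<Longrightarrow> P g (L ^ Suc n)"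
  proof (rule exponential_growth[of P a])
    show "\<exists>c. P g c" if "g \<in> carrier G" for g
      by (rule projective_action_Lipschitz[OF inv[OF that]]) (auto simp: P_def)
    show "P g c" if "P g b" "b \<le> c" for g b c
      using that mult_right_mono[OF that(2) sin_proj_dist_nonneg] unfolding P_def by (meson order_trans)
    show "P (mult G g h) (b * c)" if gh: "g \<in> carrier G" "h \<in> carrier G" "P g b" "P h c" for g h b c
      unfolding P_def
    proof (intro conjI ballI)
      show "0 \<le> b * c" using gh by (simp add: P_def)
      fix L M :: "('k ^ 'n) set" assume LM: "L \<in> projective_space" "M \<in> projective_space"
      have \<rho>: "\<rho> (mult G g h) = \<rho> g ** \<rho> h" using hom_mult[OF hom gh(1,2)] by (simp add: GL_def)
      have "sin (proj_dist ip (projective_action (\<rho> (mult G g h)) L) (projective_action (\<rho> (mult G g h)) M))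
          \<le> b * sin (proj_dist ip (projective_action (\<rho> h) L) (projective_action (\<rho> h) M))"
        using gh(3) projective_action_closed[OF inv[OF gh(2)]] LM
        unfolding P_def \<rho> projective_action_mult by blast
      also have "\<dots> \<le> b * (c * sin (proj_dist ip L M))"
        using gh(3,4) LM by (intro mult_left_mono) (auto simp: P_def)
      finally show "sin (proj_dist ip (projective_action (\<rho> (mult G g h)) L) (projective_action (\<rho> (mult G g h)) M))
          \<le> b * c * sin (proj_dist ip L M)" by (simp add: mult.assoc)
    qed
  qed blast
  have L1: "L > 1" using L(1) a by simp
  \<comment> \<open>Writing \<open>L\<close> as a power of \<open>a\<close> converts growth in
    \<open>t\<close> into a power of the visual distance; \<open>L \<ge> a\<close> gives
    \<open>b \<ge> 1\<close>.\<close>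
  define b where "b = log a L"
  have b: "b \<ge> 1" "a powr b = L" using a L(1) L1 by (auto simp: b_def le_log_iff)
  define C where "C = 5 * \<delta> + 1 + D"
  \<comment> \<open>The least visual distance that a boundary product of at most \<open>C\<close>
    allows.\<close>
  define e where "e = inverse r * a powr - C"
  have e: "e > 0" using r a by (simp add: e_def)
  obtain h where h: "h > 0" "\<And>u v. u \<in> ?B \<Longrightarrow> v \<in> ?B \<Longrightarrow> d u v \<ge> e \<Longrightarrow> proj_dist ip (\<xi> u) (\<xi> v) \<ge> h"
    by (rule inj_continuous_uniformly_separated[OF V.Metric_space_axioms Q.Metric_space_axioms
          compact_space_visual[OF _ a vis] cont inj e])
      (use model in \<open>auto simp: model_space_def\<close>)
  \<comment> \<open>The sine increases on the interval from 0 to \<open>pi / 2\<close>, where all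
    projective angles lie, but \<open>h\<close> itself may be larger.\<close>
  define \<sigma> where "\<sigma> = sin (min h (pi / 2))"
  have \<sigma>: "\<sigma> > 0" unfolding \<sigma>_def using h(1) pi_gt_zero by (intro sin_gt_zero) (auto simp: min_def)
  have \<xi>B: "\<xi> x \<in> projective_space" if "x \<in> ?B" for x
    using continuous_map_image_subset_topspace[OF cont] that by auto
  have main: "\<sigma> * L powr - (D + 2) * r powr - b * d x y powr b \<le> proj_dist ip (\<xi> x) (\<xi> y)"
    if x: "x \<in> ?B" and y: "y \<in> ?B" and "x \<noteq> y" for x y
  proof -
    have "d x y > 0" using V.mdist_pos_less[OF \<open>x \<noteq> y\<close> x y] .
    then have "boundary_product x\<^sub>0 x y \<noteq> \<infinity>"
      using r(3)[OF x y] by (auto simp: exp_neg_def)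
    then obtain t where t: "boundary_product x\<^sub>0 x y = ereal t" "t \<ge> 0"
      using boundary_product_nonneg[OF x y] by (cases "boundary_product x\<^sub>0 x y") auto
    obtain g where g: "g \<in> carrier G" "dist (\<phi> g x\<^sub>0) x\<^sub>0 \<le> t + D"
      "boundary_product x\<^sub>0 (boundary_action \<phi> g x) (boundary_action \<phi> g y) \<le> ereal C"
      unfolding C_def by (rule boundary_expansion[OF D(2) hyp x y t(1)])
    let ?x = "boundary_action \<phi> g x" and ?y = "boundary_action \<phi> g y"
    have gB: "?x \<in> ?B" "?y \<in> ?B" using boundary_action_closed[OF g(1)] x y by auto
    have "e \<le> inverse r * exp_neg a (boundary_product x\<^sub>0 ?x ?y)"
      unfolding e_def using r(1) by (intro mult_left_mono exp_neg_ge[OF a boundary_product_nonneg[OF gB] g(3)]) auto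
    then have "h \<le> proj_dist ip (\<xi> ?x) (\<xi> ?y)" using h(2)[OF gB] r(2)[OF gB] by simp
    then have "\<sigma> \<le> sin (proj_dist ip (\<xi> ?x) (\<xi> ?y))"
      unfolding \<sigma>_def using h(1) proj_dist_bounds[of "\<xi> ?x" "\<xi> ?y"] pi_gt_zero
      by (intro sin_monotone_2pi_le) auto
    \<comment> \<open>Rounding up costs at most 1 and \<open>Suc n\<close> another 1, whence the
      exponent \<open>t + D + 2\<close>.\<close>
    also define n where "n = nat \<lceil>t + D\<rceil>"
    have n: "t + D \<le> real n" "real n \<le> t + D + 1"
      using t(2) D(1) by (auto simp: n_def intro: real_nat_ceiling_ge)
    have "P g (L ^ Suc n)" using L(2)[OF g(1)] g(2) n(1) by simp
    then have "sin (proj_dist ip (\<xi> ?x) (\<xi> ?y)) \<le> L ^ Suc n * sin (proj_dist ip (\<xi> x) (\<xi> y))"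
      using \<xi>B x y unfolding P_def by (simp add: equiv[OF g(1)])
    also have "\<dots> \<le> L powr (t + D + 2) * proj_dist ip (\<xi> x) (\<xi> y)"
    proof (rule mult_mono)
      have "L ^ Suc n = L powr real (Suc n)" using L1 by (subst powr_realpow) auto
      also have "\<dots> \<le> L powr (t + D + 2)" using L1 n by (intro powr_mono) auto
      finally show "L ^ Suc n \<le> L powr (t + D + 2)" .
      show "sin (proj_dist ip (\<xi> x) (\<xi> y)) \<le> proj_dist ip (\<xi> x) (\<xi> y)"
        by (rule sin_x_le_x) (rule proj_dist_bounds)
    qed (auto simp: sin_proj_dist_nonneg)
    finally have "\<sigma> / L powr (t + D + 2) \<le> proj_dist ip (\<xi> x) (\<xi> y)"
      using L1 by (subst pos_divide_le_eq) (auto simp: mult.commute)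
    then have lower: "\<sigma> * L powr - (t + D + 2) \<le> proj_dist ip (\<xi> x) (\<xi> y)"
      by (simp only: powr_minus divide_inverse)
    have "d x y \<le> r * a powr - t" using r(3)[OF x y] by (simp add: t exp_neg_def)
    then have "d x y powr b \<le> (r * a powr - t) powr b" using b(1) by (intro powr_mono2) auto
    also have "\<dots> = r powr b * (a powr b) powr - t"
      using r(1) by (simp add: powr_mult powr_powr mult.commute)
    also have "\<dots> = r powr b * L powr - t" by (simp only: b(2))
    \<comment> \<open>The constant is built so that \<open>r powr - b\<close> cancels
      \<open>r powr b\<close> and \<open>L powr - (D + 2)\<close> completes
      \<open>L powr - t\<close> to the bound in \<open>lower\<close>.\<close>
    finally have "\<sigma> * L powr - (D + 2) * r powr - b * d x y powr b
        \<le> \<sigma> * L powr - (D + 2) * r powr - b * (r powr b * L powr - t)"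
      using \<sigma> by (intro mult_left_mono) auto
    also have "\<dots> = \<sigma> * (L powr - (D + 2) * L powr - t)" using r(1) by (simp add: powr_minus)
    also have "\<dots> = \<sigma> * L powr - (t + D + 2)" by (simp add: algebra_simps flip: powr_add)
    finally show ?thesis using lower by simp
  qed
  show thesis
  proof
    show "\<sigma> * L powr - (D + 2) * r powr - b > 0" using \<sigma> L1 r(1) by simp
    show "b \<ge> 1" by fact
    show "\<sigma> * L powr - (D + 2) * r powr - b * d x y powr b \<le> proj_dist ip (\<xi> x) (\<xi> y)"
      if "x \<in> ?B" "y \<in> ?B" for x y
      \<comment> \<open>On the diagonal the left side vanishes, as
        \<open>0 powr b = 0\<close>.\<close>
      using main[OF that] V.zero[OF that] proj_dist_bounds(1)[of "\<xi> x" "\<xi> y"] by (cases "x = y") auto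
  qed
qed

lemma (in scalar_product) equivariant_map_inverse_hoelder:
  fixes G :: "('g, 'b) monoid_scheme" and \<phi> :: "'g \<Rightarrow> 'x::metric_space \<Rightarrow> 'x" and x\<^sub>0 :: 'x
    and \<rho> :: "'g \<Rightarrow> 'k ^ 'n ^ 'n"
  assumes "model_space G \<phi>" "a > 1" and vis: "visual_metric x\<^sub>0 a d"
    and "\<rho> \<in> hom G GL"
    and "continuous_map (Metric_space.mtopology (gromov_boundary x\<^sub>0) d)
      (Metric_space.mtopology projective_space (proj_dist ip)) \<xi>"
    and "\<forall>g\<in>carrier G. \<forall>x\<in>gromov_boundary x\<^sub>0. \<xi> (boundary_action \<phi> g x) = projective_action (\<rho> g) (\<xi> x)"
    and inj: "inj_on \<xi> (gromov_boundary x\<^sub>0)"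
  shows "hoelder_continuous_on (\<xi> ` gromov_boundary x\<^sub>0) (proj_dist ip) d (inv_into (gromov_boundary x\<^sub>0) \<xi>) \<and>
    (\<exists>c>0. \<exists>\<beta>>0. \<forall>x\<in>gromov_boundary x\<^sub>0. \<forall>y\<in>gromov_boundary x\<^sub>0.
      proj_dist ip (\<xi> x) (\<xi> y) \<ge> c * d x y powr \<beta>)"
proof -
  interpret V: Metric_space "gromov_boundary x\<^sub>0" d using vis by (simp add: visual_metric_def)
  obtain c b where cb: "c > 0" "b \<ge> 1" "\<And>x y. x \<in> gromov_boundary x\<^sub>0 \<Longrightarrow> y \<in> gromov_boundary x\<^sub>0 \<Longrightarrow>
      c * d x y powr b \<le> proj_dist ip (\<xi> x) (\<xi> y)"
    by (rule equivariant_map_lower_bound[of G \<phi> a x\<^sub>0 d \<rho> \<xi>]) (use assms in blast)+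
  then have "b > 0" by simp
  moreover have "hoelder_continuous_on (\<xi> ` gromov_boundary x\<^sub>0) (proj_dist ip) d (inv_into (gromov_boundary x\<^sub>0) \<xi>)"
    using inj cb(1,2) V.nonneg cb(3) by (rule hoelder_continuous_on_inv_into)
  ultimately show ?thesis using cb by blast
qed

theorem theorem1p7:
  fixes G :: "('g, 'b) monoid_scheme"
    and \<phi> :: "'g \<Rightarrow> 'x::metric_space \<Rightarrow> 'x"
    and x\<^sub>0 :: 'x
    and a :: real
    and d\<^sub>a :: "(nat \<Rightarrow> 'x) set \<Rightarrow> (nat \<Rightarrow> 'x) set \<Rightarrow> real"
  assumes "word_hyperbolic G" and "\<not> elementary G" and "model_space G \<phi>"
    and "a > 1" and "visual_metric x\<^sub>0 a d\<^sub>a"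
  shows "(\<forall>(\<rho> :: 'g \<Rightarrow> real ^ 'n ^ 'n) \<xi>.
          \<rho> \<in> hom G GL \<and>
          continuous_map (Metric_space.mtopology (gromov_boundary x\<^sub>0) d\<^sub>a)
            (Metric_space.mtopology projective_space (proj_dist inner)) \<xi> \<and>
          (\<forall>g\<in>carrier G. \<forall>x\<in>gromov_boundary x\<^sub>0.
             \<xi> (boundary_action \<phi> g x) = projective_action (\<rho> g) (\<xi> x)) \<and>
          inj_on \<xi> (gromov_boundary x\<^sub>0) \<longrightarrow>
          hoelder_continuous_on (\<xi> ` gromov_boundary x\<^sub>0) (proj_dist inner) d\<^sub>a
            (inv_into (gromov_boundary x\<^sub>0) \<xi>) \<and>
          (\<exists>c>0. \<exists>\<beta>>0. \<forall>x\<in>gromov_boundary x\<^sub>0. \<forall>y\<in>gromov_boundary x\<^sub>0.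
             proj_dist inner (\<xi> x) (\<xi> y) \<ge> c * d\<^sub>a x y powr \<beta>)) \<and>
         (\<forall>(\<rho> :: 'g \<Rightarrow> complex ^ 'n ^ 'n) \<xi>.
          \<rho> \<in> hom G GL \<and>
          continuous_map (Metric_space.mtopology (gromov_boundary x\<^sub>0) d\<^sub>a)
            (Metric_space.mtopology projective_space (proj_dist cinner)) \<xi> \<and>
          (\<forall>g\<in>carrier G. \<forall>x\<in>gromov_boundary x\<^sub>0.
             \<xi> (boundary_action \<phi> g x) = projective_action (\<rho> g) (\<xi> x)) \<and>
          inj_on \<xi> (gromov_boundary x\<^sub>0) \<longrightarrow>
          hoelder_continuous_on (\<xi> ` gromov_boundary x\<^sub>0) (proj_dist cinner) d\<^sub>a
            (inv_into (gromov_boundary x\<^sub>0) \<xi>) \<and>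
          (\<exists>c>0. \<exists>\<beta>>0. \<forall>x\<in>gromov_boundary x\<^sub>0. \<forall>y\<in>gromov_boundary x\<^sub>0.
             proj_dist cinner (\<xi> x) (\<xi> y) \<ge> c * d\<^sub>a x y powr \<beta>))"
  using inner.equivariant_map_inverse_hoelder[OF assms(3-5)]
    cinner.equivariant_map_inverse_hoelder[OF assms(3-5)]
  by (intro conjI allI impI; elim conjE) blast+

end
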